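(* Let $\mathcal{X}\subseteq\mathbb{R}^d$ be a compact convex set with nonempty interior and with $0\notin\mathcal{X}$. Let $\Delta$ be a set equipped with a probability measure $\mathbb{P}$, and let $\{a_\delta\}_{\delta\in\Delta}$, $\{b_\delta\}_{\delta\in\Delta}$ be collections of vectors in $\mathbb{R}^d$ such that $b_\delta^\top x>0$ for all $x\in\mathcal{X}$ and $\delta\in\Delta$. Let $c:\mathcal{X}\to\mathbb{R}$ be a strongly convex function. For a finite set $\omega\subseteq\Delta$, let $\mathcal{P}(\omega)$ be the sampled quasi-linear optimization problem $$\min_{x\in\mathbb{R}^d,\ \lambda\ge 0}\ (\lambda,c(x))\quad\text{s.t.}\quad x\in\mathcal{X},\quad a_\delta^\top x\le\lambda\, b_\delta^\top x\ \ \forall\,\delta\in\omega,$$ where the minimum is with respect to the lexicographical order. Assume that for every positive integer $M$, the vector $\bar\omega_M=(\delta_1,\ldots,\delta_M)\in\Delta^M$ (with law $\mathbb{P}^M$) is non-degenerate with probability one. Let $\zeta$ be a positive integer that is an upper bound on the cardinality of any essential set of $\mathcal{P}(\omega)$, for all finite $\omega\subseteq\Delta$. Let $N\in\mathbb{N}$ with $N\ge\zeta$, and let $\varepsilon\in(0,1)$. Then $$\mathbb{P}^N\big(\{\bar\omega_N\in\Delta^N : V(\bar\omega_N)>\varepsilon\}\big)\le\Phi(\varepsilon,\zeta-1,N).$$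
   Context: Lexicographical order: $(\lambda_1,c_1)<(\lambda_2,c_2)$ if $\lambda_1<\lambda_2$, or else $\lambda_1=\lambda_2$ and $c_1<c_2$. For finite $\omega\subseteq\Delta$, $\mathrm{Opt}(\omega)$ denotes the optimal solution $(\lambda^*,x^* )$ of $\mathcal{P}(\omega)$ (unique by strong convexity of $c$), and $\mathrm{Cost}(\omega)=(\lambda^*,c(x^* ))$ denotes its optimal cost. For $\bar\omega_N=(\delta_1,\ldots,\delta_N)\in\Delta^N$, $\omega_N=\{\delta_1,\ldots,\delta_N\}$ denotes the set of its elements. $\mathbb{P}^N$ is the product measure on $\Delta^N$ (i.i.d. sampling of the constraints according to $\mathbb{P}$). Essential set: an essential set for $\mathcal{P}(\omega)$ is a set $\beta\subseteq\omega$ satisfying $\mathrm{Cost}(\beta)=\mathrm{Cost}(\omega)$, and with minimal cardinality among the subsets of $\omega$ with this property. Non-degenerate: $\bar\omega_N=(\delta_1,\ldots,\delta_N)\in\Delta^N$ is non-degenerate if there is a unique index set $I\subseteq\{1,\ldots,N\}$ such that $\{\delta_i\}_{i\in I}$ is an essential set for $\mathcal{P}(\omega_N)$. Violating probability: $V(\bar\omega_N)=\mathbb{P}(\{\delta\in\Delta : \mathrm{Cost}(\omega_N\cup\{\delta\})>\mathrm{Cost}(\omega_N)\})$. All sets whose probability is taken are implicitly assumed measurable. The function $\Phi$ (expressible as a regularized incomplete beta function) is $\Phi(\varepsilon,k,N)=\sum_{j=0}^{k}\binom{N}{j}\varepsilon^j(1-\varepsilon)^{N-j}$. *)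

theory Defs
  imports "HOL-Probability.Probability"
begin

definition strongly_convex_on :: "'v::real_normed_vector set \<Rightarrow> ('v \<Rightarrow> real) \<Rightarrow> bool" where
  "strongly_convex_on S f \<longleftrightarrow> convex S \<and>
     (\<exists>m>0. \<forall>x\<in>S. \<forall>y\<in>S. \<forall>t\<in>{0..1}.
        f ((1 - t) *\<^sub>R x + t *\<^sub>R y)
          \<le> (1 - t) * f x + t * f y - m / 2 * t * (1 - t) * (norm (x - y))\<^sup>2)"

text \<open>\<open>HOL-Analysis\<close> orders pairs componentwise, which excludes the instances of
  \<open>Product_Lexorder\<close>; hence an explicit lexicographic order.\<close>

definition lex_less :: "real \<times> real \<Rightarrow> real \<times> real \<Rightarrow> bool" (infix \<open>\<prec>\<^sub>l\<^sub>e\<^sub>x\<close> 50) where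
  "p \<prec>\<^sub>l\<^sub>e\<^sub>x q \<longleftrightarrow> fst p < fst q \<or> (fst p = fst q \<and> snd p < snd q)"

definition lex_le :: "real \<times> real \<Rightarrow> real \<times> real \<Rightarrow> bool" (infix \<open>\<preceq>\<^sub>l\<^sub>e\<^sub>x\<close> 50) where
  "p \<preceq>\<^sub>l\<^sub>e\<^sub>x q \<longleftrightarrow> p \<prec>\<^sub>l\<^sub>e\<^sub>x q \<or> p = q"

text \<open>The data of the problem are the set \<open>X\<close>, the vectors \<open>a \<delta>\<close>, \<open>b \<delta>\<close> and the
  function \<open>c\<close>, of which only the values on \<open>X\<close> matter; \<open>\<omega>\<close> is the set of sampled
  constraints. A solution is a pair \<open>(l, x)\<close>, with \<open>l\<close> in the role of \<open>\<lambda>\<close>.\<close>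

definition feasible_set ::
  "(real ^ 'd) set \<Rightarrow> ('s \<Rightarrow> real ^ 'd) \<Rightarrow> ('s \<Rightarrow> real ^ 'd) \<Rightarrow> 's set \<Rightarrow> (real \<times> (real ^ 'd)) set" where
  "feasible_set X a b \<omega> =
     {(l, x). l \<ge> 0 \<and> x \<in> X \<and> (\<forall>\<delta>\<in>\<omega>. a \<delta> \<bullet> x \<le> l * (b \<delta> \<bullet> x))}"

definition objective :: "(real ^ 'd \<Rightarrow> real) \<Rightarrow> real \<times> (real ^ 'd) \<Rightarrow> real \<times> real" where
  "objective c p = (fst p, c (snd p))"

definition is_optimal ::
  "(real ^ 'd) set \<Rightarrow> ('s \<Rightarrow> real ^ 'd) \<Rightarrow> ('s \<Rightarrow> real ^ 'd) \<Rightarrow> (real ^ 'd \<Rightarrow> real) \<Rightarrow> 's set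
     \<Rightarrow> real \<times> (real ^ 'd) \<Rightarrow> bool" where
  "is_optimal X a b c \<omega> p \<longleftrightarrow> p \<in> feasible_set X a b \<omega> \<and>
     (\<forall>q\<in>feasible_set X a b \<omega>. objective c p \<preceq>\<^sub>l\<^sub>e\<^sub>x objective c q)"

definition Opt ::
  "(real ^ 'd) set \<Rightarrow> ('s \<Rightarrow> real ^ 'd) \<Rightarrow> ('s \<Rightarrow> real ^ 'd) \<Rightarrow> (real ^ 'd \<Rightarrow> real) \<Rightarrow> 's set
     \<Rightarrow> real \<times> (real ^ 'd)" where
  "Opt X a b c \<omega> = (THE p. is_optimal X a b c \<omega> p)"

definition Cost ::
  "(real ^ 'd) set \<Rightarrow> ('s \<Rightarrow> real ^ 'd) \<Rightarrow> ('s \<Rightarrow> real ^ 'd) \<Rightarrow> (real ^ 'd \<Rightarrow> real) \<Rightarrow> 's set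
     \<Rightarrow> real \<times> real" where
  "Cost X a b c \<omega> = objective c (Opt X a b c \<omega>)"

definition essential_set ::
  "(real ^ 'd) set \<Rightarrow> ('s \<Rightarrow> real ^ 'd) \<Rightarrow> ('s \<Rightarrow> real ^ 'd) \<Rightarrow> (real ^ 'd \<Rightarrow> real)
     \<Rightarrow> 's set \<Rightarrow> 's set \<Rightarrow> bool" where
  "essential_set X a b c \<omega> \<beta> \<longleftrightarrow> \<beta> \<subseteq> \<omega> \<and> Cost X a b c \<beta> = Cost X a b c \<omega> \<and>
     (\<forall>\<beta>'. \<beta>' \<subseteq> \<omega> \<and> Cost X a b c \<beta>' = Cost X a b c \<omega> \<longrightarrow> card \<beta> \<le> card \<beta>')"

text \<open>A sample \<open>(\<delta>\<^sub>1, \<dots>, \<delta>\<^sub>N)\<close> is a function \<open>s\<close> on the index set \<open>{1..N}\<close>, i.e. a point of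
  the product measure below; the set of its elements is \<open>s ` {1..N}\<close>.\<close>

abbreviation sample_measure :: "'s measure \<Rightarrow> nat \<Rightarrow> (nat \<Rightarrow> 's) measure" where
  "sample_measure P N \<equiv> PiM {1..N} (\<lambda>_. P)"

definition non_degenerate ::
  "(real ^ 'd) set \<Rightarrow> ('s \<Rightarrow> real ^ 'd) \<Rightarrow> ('s \<Rightarrow> real ^ 'd) \<Rightarrow> (real ^ 'd \<Rightarrow> real)
     \<Rightarrow> nat \<Rightarrow> (nat \<Rightarrow> 's) \<Rightarrow> bool" where
  "non_degenerate X a b c N s \<longleftrightarrow>
     (\<exists>!I. I \<subseteq> {1..N} \<and> essential_set X a b c (s ` {1..N}) (s ` I))"

definition violating_prob ::
  "'s measure \<Rightarrow> (real ^ 'd) set \<Rightarrow> ('s \<Rightarrow> real ^ 'd) \<Rightarrow> ('s \<Rightarrow> real ^ 'd) \<Rightarrow> (real ^ 'd \<Rightarrow> real)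
     \<Rightarrow> nat \<Rightarrow> (nat \<Rightarrow> 's) \<Rightarrow> real" where
  "violating_prob P X a b c N s =
     measure P {\<delta> \<in> space P. Cost X a b c (s ` {1..N}) \<prec>\<^sub>l\<^sub>e\<^sub>x Cost X a b c (s ` {1..N} \<union> {\<delta>})}"

text \<open>The standing assumption that all events under consideration are measurable: for every
  sample size, the event that a given subsample has a smaller cost than the whole sample.
  Taking \<open>M = N + 1\<close> and \<open>I = {1..N}\<close> gives the (joint) measurability of the
  violation event, and hence, by Fubini, that of \<open>violating_prob\<close> as a function of the
  sample. Since the cost is monotone in the set of constraints, non-degeneracy is also
  a Boolean combination of such events.\<close>

definition cost_events_measurable ::
  "'s measure \<Rightarrow> (real ^ 'd) set \<Rightarrow> ('s \<Rightarrow> real ^ 'd) \<Rightarrow> ('s \<Rightarrow> real ^ 'd) \<Rightarrow> (real ^ 'd \<Rightarrow> real)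
     \<Rightarrow> bool" where
  "cost_events_measurable P X a b c \<longleftrightarrow>
     (\<forall>M. \<forall>I \<subseteq> {1..M}.
        {s \<in> space (sample_measure P M). Cost X a b c (s ` I) \<prec>\<^sub>l\<^sub>e\<^sub>x Cost X a b c (s ` {1..M})}
          \<in> sets (sample_measure P M))"

definition Phi :: "real \<Rightarrow> nat \<Rightarrow> nat \<Rightarrow> real" where
  "Phi \<epsilon> k N = (\<Sum>j=0..k. real (N choose j) * \<epsilon> ^ j * (1 - \<epsilon>) ^ (N - j))"

text \<open>Real-valued convex functions on a compact convex set need not attain their minimum, as
  they may jump upwards at the boundary. An optimal solution does exist whenever \<open>c\<close> is
  continuous on \<open>X\<close>.\<close>

lemma is_optimal_exists_if_continuous:
  fixes X :: "(real ^ 'd) set"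
  assumes X: "compact X" "X \<noteq> {}" and c: "continuous_on X c"
    and b: "\<And>\<delta> x. \<delta> \<in> \<omega> \<Longrightarrow> x \<in> X \<Longrightarrow> b \<delta> \<bullet> x > 0" and fin: "finite \<omega>"
  shows "\<exists>p. is_optimal X a b c \<omega> p"
proof -
  obtain x0 where x0: "x0 \<in> X" using X(2) by blast
  define L where "L = Max (insert 0 ((\<lambda>\<delta>. (a \<delta> \<bullet> x0) / (b \<delta> \<bullet> x0)) ` \<omega>))"
  have L0: "L \<ge> 0" unfolding L_def by (rule Max_ge) (use fin in auto)
  have Lx0: "a \<delta> \<bullet> x0 \<le> L * (b \<delta> \<bullet> x0)" if "\<delta> \<in> \<omega>" for \<delta>
  proof -
    have "(a \<delta> \<bullet> x0) / (b \<delta> \<bullet> x0) \<le> L" unfolding L_def by (rule Max_ge) (use fin that in auto)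
    then show ?thesis using b[OF that x0] by (simp add: pos_divide_le_eq)
  qed
  define K where "K = ({0..L} \<times> X) \<inter> (\<Inter>\<delta>\<in>\<omega>. {p. a \<delta> \<bullet> snd p \<le> fst p * (b \<delta> \<bullet> snd p)})"
  have "compact K" unfolding K_def
    by (intro compact_Int_closed compact_Times X compact_Icc closed_INT ballI closed_Collect_le
        continuous_intros)
  moreover have "(L, x0) \<in> K" using L0 x0 Lx0 by (auto simp: K_def)
  ultimately obtain p where p: "p \<in> K" "\<And>q. q \<in> K \<Longrightarrow> fst p \<le> fst q"
    using continuous_attains_inf[of K fst] continuous_on_fst[OF continuous_on_id] by blast
  define Y where "Y = X \<inter> (\<Inter>\<delta>\<in>\<omega>. {x. a \<delta> \<bullet> x \<le> fst p * (b \<delta> \<bullet> x)})"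
  have "compact Y" unfolding Y_def
    by (intro compact_Int_closed X closed_INT ballI closed_Collect_le continuous_intros)
  moreover have "snd p \<in> Y" using p(1) by (auto simp: K_def Y_def)
  moreover have "continuous_on Y c" by (rule continuous_on_subset[OF c]) (auto simp: Y_def)
  ultimately obtain x where x: "x \<in> Y" "\<And>y. y \<in> Y \<Longrightarrow> c x \<le> c y"
    using continuous_attains_inf[of Y c] by blast
  have "is_optimal X a b c \<omega> (fst p, x)"
    unfolding is_optimal_def
  proof (intro conjI ballI)
    show "(fst p, x) \<in> feasible_set X a b \<omega>"
      using p(1) x(1) by (auto simp: feasible_set_def K_def Y_def)
  next
    fix q assume q: "q \<in> feasible_set X a b \<omega>"
    have le: "fst p \<le> fst q"
    proof (cases "fst q \<le> L")
      case True
      then have "q \<in> K" using q by (auto simp: feasible_set_def K_def)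
      then show ?thesis by (rule p(2))
    next
      case False
      then show ?thesis using p(1) by (auto simp: K_def)
    qed
    show "objective c (fst p, x) \<preceq>\<^sub>l\<^sub>e\<^sub>x objective c q"
    proof (cases "fst p = fst q")
      case True
      then have "snd q \<in> Y" using q by (auto simp: feasible_set_def Y_def)
      then show ?thesis using x(2)[of "snd q"] True
        by (auto simp: objective_def lex_le_def lex_less_def)
    next
      case False
      then show ?thesis using le by (auto simp: objective_def lex_le_def lex_less_def)
    qed
  qed
  then show ?thesis by blast
qed

end

theory Submission
  imports Defs
begin

text \<open>Let \<open>F k\<close> be the law of the satisfaction probability \<open>t = 1 - V\<close> of a sample of size
  \<open>k\<close> which is its own essential set. By exchangeability and Fubini, the essential set of a sample
  of size \<open>M\<close> has size \<open>k\<close> and satisfaction probability in \<open>U\<close> with probability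
  \<open>(M choose k) * (\<integral>t\<in>U. t ^ (M - k) \<partial>F k)\<close>. Summing over \<open>k \<le> \<zeta>\<close> with \<open>U\<close> the whole
  line gives \<open>1\<close> for every \<open>M\<close>, that is, \<open>(\<Sum>k\<le>\<zeta>. \<integral>t. \<xi>\<^sup>(\<^sup>k\<^sup>) t / k! \<partial>F k) = \<xi> 1\<close> for all polynomials \<open>\<xi>\<close>.
  The probability of \<open>V > \<epsilon>\<close> is therefore at most \<open>\<xi> 1\<close> as soon as each \<open>\<xi>\<^sup>(\<^sup>k\<^sup>) / k!\<close>
  dominates \<open>(N choose k) * t ^ (N - k)\<close> on \<open>{0..<1 - \<epsilon>}\<close> and is nonnegative on \<open>{0..1}\<close>.\<close>

section \<open>A moment problem\<close>

text \<open>These are the Taylor coefficients of \<open>(t - u) ^ m\<close>, its \<open>k\<close>-th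
  derivatives divided by \<open>k!\<close>; this normalization produces the factor
  \<open>Suc k\<close>. Truncated subtraction is harmless: for \<open>k \<ge> m\<close> both the
  derivative and \<open>m choose Suc k\<close> vanish.\<close>

lemma binomial_power_has_derivative:
  fixes u t :: real
  shows "((\<lambda>t. real (m choose k) * (t - u) ^ (m - k)) has_real_derivative
           real (Suc k) * (real (m choose Suc k) * (t - u) ^ (m - Suc k))) (at t)"
proof -
  have "real (m choose k) * real (m - k) = real (Suc k) * real (m choose Suc k)"
    by (metis binomial_absorb_comp mult.commute of_nat_mult binomial_absorption)
  then have "real (m choose k) * (real (m - k) * (t - u) ^ (m - Suc k))
      = real (Suc k) * (real (m choose Suc k) * (t - u) ^ (m - Suc k))"
    by (simp only: mult.assoc[symmetric])
  moreover have "((\<lambda>t. real (m choose k) * (t - u) ^ (m - k)) has_real_derivative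
      real (m choose k) * (real (m - k) * (t - u) ^ (m - Suc k))) (at t)"
    by (auto intro!: derivative_eq_intros)
  ultimately show ?thesis by (simp only:)
qed

text \<open>Descending induction on the order: where the next derivative is nonnegative, the current
  one is nondecreasing, hence at least its value at \<open>u\<close>. With \<open>F k\<close> read
  as the \<open>k\<close>-th derivative over \<open>k!\<close> of one function, sign checks at order
  \<open>n\<close> and at the point \<open>u\<close> settle all lower orders.\<close>

lemma taylor_family_nonneg:
  fixes F :: "nat \<Rightarrow> real \<Rightarrow> real"
  assumes deriv: "\<And>k t. k < n \<Longrightarrow> (F k has_real_derivative real (Suc k) * F (Suc k) t) (at t)"
    and init: "\<And>k. k < n \<Longrightarrow> F k u \<ge> 0"
    and top: "\<And>t. u \<le> t \<Longrightarrow> t \<le> v \<Longrightarrow> F n t \<ge> 0"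
    and "k \<le> n" "u \<le> t" "t \<le> v"
  shows "F k t \<ge> 0"
  using \<open>k \<le> n\<close> \<open>u \<le> t\<close> \<open>t \<le> v\<close>
proof (induction k arbitrary: t rule: inc_induct)
  case base
  then show ?case using top by simp
next
  case (step k)
  have "F k u \<le> F k t"
    by (rule DERIV_nonneg_imp_nondecreasing)
      (use step deriv[of k] in \<open>auto intro!: exI mult_nonneg_nonneg\<close>)
  then show ?case using init[of k] step.hyps by simp
qed

text \<open>The witness is a polynomial approximation of the function which is \<open>t ^ N\<close> up to
  \<open>t0\<close> and its Taylor polynomial of degree \<open>\<zeta> - 1\<close> at \<open>t0\<close> from there on; the value
  at \<open>1\<close> of this Taylor polynomial is \<open>Phi (1 - t0) (\<zeta> - 1) N\<close>.\<close>

lemma dual_polynomial: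
  fixes t0 t1 \<eta> :: real
  assumes t: "0 < t0" "t0 < t1" "t1 < 1" and \<eta>: "0 < \<eta>" and \<zeta>: "0 < \<zeta>" "\<zeta> \<le> N"
  obtains \<alpha> :: "nat \<Rightarrow> real" and n where
    "\<And>k t. k \<le> \<zeta> \<Longrightarrow> 0 \<le> t \<Longrightarrow> t \<le> 1 \<Longrightarrow>
       real (N choose k) * (indicator {..<t0} t * t ^ (N - k))
         \<le> (\<Sum>m\<le>n. \<alpha> m * (real (m choose k) * t ^ (m - k)))"
    "(\<Sum>m\<le>n. \<alpha> m) \<le> Phi (1 - t1) (\<zeta> - 1) N + \<eta>"
proof -
  \<comment> \<open>A continuous cutoff between \<open>t0\<close> and \<open>t1\<close> replaces the
    jump of the highest derivative, because uniform polynomial approximation needs a continuous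
    function. The price is that the Taylor expansion takes place at \<open>t1\<close>.\<close>
  define \<psi> where "\<psi> t = max 0 (min 1 ((t1 - t) / (t1 - t0)))" for t
  have \<psi>: "0 \<le> \<psi> t" "\<psi> t \<le> 1" "t \<le> t0 \<Longrightarrow> \<psi> t = 1" "t \<ge> t1 \<Longrightarrow> \<psi> t = 0" for t
    using t by (auto simp: \<psi>_def field_simps min_def max_def)
  \<comment> \<open>The intended derivative of order \<open>\<zeta>\<close> (over
    \<open>\<zeta>!\<close>) of the witness: that of \<open>t ^ N\<close>, faded out by the
    cutoff.\<close>
  define g where "g t = real (N choose \<zeta>) * t ^ (N - \<zeta>) * \<psi> t" for t
  \<comment> \<open>The shift by \<open>\<eta> / 2\<close> turns a two-sided approximation into
    \<open>g \<le> p \<le> g + \<eta>\<close>.\<close>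
  have "continuous_on {0..1} (\<lambda>t. g t + \<eta> / 2)"
    unfolding g_def \<psi>_def using t by (intro continuous_intros) auto
  then obtain p :: "real \<Rightarrow> real" where p: "real_polynomial_function p"
      and close: "\<And>t. t \<in> {0..1} \<Longrightarrow> \<bar>g t + \<eta> / 2 - p t\<bar> < \<eta> / 2"
    using Stone_Weierstrass_real_polynomial_function[of "{0..1}" "\<lambda>t. g t + \<eta> / 2" "\<eta> / 2"] \<eta>
    by (metis compact_Icc half_gt_zero)
  obtain d l where pd: "p = (\<lambda>t. \<Sum>i\<le>l. d i * t ^ i)"
    using p unfolding real_polynomial_function_iff_sum by blast
  have p_ge: "g t \<le> p t" and p_le: "p t \<le> g t + \<eta>" if "0 \<le> t" "t \<le> 1" for t
    using close[of t] that by (auto simp: abs_if split: if_splits)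
  have g0: "g t \<ge> 0" if "0 \<le> t" for t using that \<psi> by (simp add: g_def)
  have g_le: "g t \<le> real (N choose \<zeta>) * t ^ (N - \<zeta>)" if "0 \<le> t" for t
    unfolding g_def using that \<psi>[of t] by (intro mult_left_le) auto
  \<comment> \<open>Dividing by \<open>m choose \<zeta>\<close> undoes the differentiation of order
    \<open>\<zeta>\<close>: \<open>\<Xi> 0\<close> becomes \<open>\<zeta>!\<close> times the
    \<open>\<zeta>\<close>-fold primitive of \<open>p\<close> that vanishes at 0 together with its
    derivatives of order below \<open>\<zeta>\<close>.\<close>
  define \<alpha> where "\<alpha> m = (if m < \<zeta> then 0 else d (m - \<zeta>) / real (m choose \<zeta>))" for m
  define W where "W u m k t = real (m choose k) * (t - u) ^ (m - k)" for u t :: real and m k :: nat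
  have W_deriv: "(W u m k has_real_derivative real (Suc k) * W u m (Suc k) t) (at t)" for u m k t
    unfolding W_def[abs_def] by (rule binomial_power_has_derivative)
  have W_0: "W u m k u = (if m = k then 1 else 0)" if "k \<le> m" for u m k
    using that by (auto simp: W_def)
  define \<Xi> where "\<Xi> k t = (\<Sum>m\<le>l + \<zeta>. \<alpha> m * W 0 m k t)" for k t
  \<comment> \<open>The normalized derivatives of the Taylor polynomial of \<open>t ^ N\<close> at
    \<open>t1\<close>, truncated below degree \<open>\<zeta>\<close>.\<close>
  define Q where "Q k t = (\<Sum>j<\<zeta>. real (N choose j) * t1 ^ (N - j) * W t1 j k t)" for k t
  have \<Xi>_deriv: "(\<Xi> k has_real_derivative real (Suc k) * \<Xi> (Suc k) t) (at t)" for k t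
    unfolding \<Xi>_def[abs_def] sum_distrib_left
    by (intro DERIV_sum DERIV_cong[OF DERIV_cmult[OF W_deriv]]) simp
  have Q_deriv: "(Q k has_real_derivative real (Suc k) * Q (Suc k) t) (at t)" for k t
    unfolding Q_def[abs_def] sum_distrib_left
    by (intro DERIV_sum DERIV_cong[OF DERIV_cmult[OF W_deriv]]) simp
  have \<Xi>_top: "\<Xi> \<zeta> t = p t" for t
  proof -
    have "\<Xi> \<zeta> t = (\<Sum>m=\<zeta>..l + \<zeta>. d (m - \<zeta>) * t ^ (m - \<zeta>))"
      unfolding \<Xi>_def by (rule sum.mono_neutral_cong_right) (auto simp: \<alpha>_def W_def)
    also have "\<dots> = p t"
      unfolding pd by (rule sum.reindex_bij_witness[of _ "\<lambda>i. i + \<zeta>" "\<lambda>m. m - \<zeta>"]) auto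
    finally show ?thesis .
  qed
  have \<Xi>_0: "\<Xi> k 0 = 0" if "k < \<zeta>" for k
    unfolding \<Xi>_def using that by (intro sum.neutral) (auto simp: \<alpha>_def W_0)
  have \<Xi>_nonneg: "\<Xi> k t \<ge> 0" if "k \<le> \<zeta>" "0 \<le> t" "t \<le> 1" for k t
    by (rule taylor_family_nonneg[where n = \<zeta> and u = 0 and v = 1, OF \<Xi>_deriv])
      (use that \<Xi>_0 p_ge g0 in \<open>auto simp: \<Xi>_top intro: order_trans\<close>)
  \<comment> \<open>On \<open>{0..t0}\<close> the cutoff is 1, so \<open>p\<close> dominates the
    derivative of order \<open>\<zeta>\<close> of \<open>t ^ N\<close>. At 0 all lower derivatives
    on both sides vanish, as \<open>\<zeta> \<le> N\<close>.\<close>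
  have "\<Xi> k t - W 0 N k t \<ge> 0" if "k \<le> \<zeta>" "0 \<le> t" "t \<le> t0" for k t
  proof (rule taylor_family_nonneg[where n = \<zeta> and u = 0 and v = t0 and F = "\<lambda>k t. \<Xi> k t - W 0 N k t"])
    show "((\<lambda>t. \<Xi> k t - W 0 N k t) has_real_derivative
        real (Suc k) * (\<Xi> (Suc k) t - W 0 N (Suc k) t)) (at t)" for k t
      by (rule DERIV_cong[OF DERIV_diff[OF \<Xi>_deriv W_deriv]]) (simp add: algebra_simps)
    show "0 \<le> \<Xi> \<zeta> t - W 0 N \<zeta> t" if "0 \<le> t" "t \<le> t0" for t
      using p_ge[of t] that t \<psi>(3)[of t] by (simp add: \<Xi>_top g_def W_def)
  qed (use that \<zeta> in \<open>auto simp: \<Xi>_0 W_0\<close>)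
  then have lower: "real (N choose k) * (indicator {..<t0} t * t ^ (N - k)) \<le> \<Xi> k t"
    if "k \<le> \<zeta>" "0 \<le> t" "t \<le> 1" for k t
    using that \<Xi>_nonneg[OF that] by (auto simp: indicator_def W_def)
  \<comment> \<open>The error \<open>\<eta>\<close> in \<open>p\<close> is paid for by the summand
    \<open>\<eta> * t ^ \<zeta>\<close>, whose derivative of order \<open>\<zeta>\<close> over
    \<open>\<zeta>!\<close> is the constant \<open>\<eta>\<close>.\<close>
  have at_t1: "W 0 N k t1 + \<eta> * W 0 \<zeta> k t1 - \<Xi> k t1 \<ge> 0" if "k \<le> \<zeta>" for k
  proof (rule taylor_family_nonneg[where n = \<zeta> and u = 0 and v = t1
        and F = "\<lambda>k t. W 0 N k t + \<eta> * W 0 \<zeta> k t - \<Xi> k t"])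
    show "((\<lambda>t. W 0 N k t + \<eta> * W 0 \<zeta> k t - \<Xi> k t) has_real_derivative
        real (Suc k) * (W 0 N (Suc k) t + \<eta> * W 0 \<zeta> (Suc k) t - \<Xi> (Suc k) t)) (at t)" for k t
      by (rule DERIV_cong[OF DERIV_diff[OF DERIV_add[OF W_deriv DERIV_cmult[OF W_deriv]] \<Xi>_deriv]])
        (simp add: algebra_simps)
    show "0 \<le> W 0 N \<zeta> t + \<eta> * W 0 \<zeta> \<zeta> t - \<Xi> \<zeta> t" if "0 \<le> t" "t \<le> t1" for t
      using p_le[of t] g_le[of t] that t by (simp add: \<Xi>_top W_def)
  qed (use that \<zeta> t in \<open>auto simp: \<Xi>_0 W_0\<close>)
  \<comment> \<open>From \<open>t1\<close> on, the Taylor polynomial takes the place of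
    \<open>t ^ N\<close>: both agree at \<open>t1\<close> in all orders below
    \<open>\<zeta>\<close>, while in order \<open>\<zeta>\<close> both \<open>Q\<close> and
    \<open>g\<close> are zero.\<close>
  have "Q 0 1 + \<eta> * W 0 \<zeta> 0 1 - \<Xi> 0 1 \<ge> 0"
  proof (rule taylor_family_nonneg[where n = \<zeta> and u = t1 and v = 1
        and F = "\<lambda>k t. Q k t + \<eta> * W 0 \<zeta> k t - \<Xi> k t"])
    show "((\<lambda>t. Q k t + \<eta> * W 0 \<zeta> k t - \<Xi> k t) has_real_derivative
        real (Suc k) * (Q (Suc k) t + \<eta> * W 0 \<zeta> (Suc k) t - \<Xi> (Suc k) t)) (at t)" for k t
      by (rule DERIV_cong[OF DERIV_diff[OF DERIV_add[OF Q_deriv DERIV_cmult[OF W_deriv]] \<Xi>_deriv]])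
        (simp add: algebra_simps)
    show "0 \<le> Q \<zeta> t + \<eta> * W 0 \<zeta> \<zeta> t - \<Xi> \<zeta> t" if "t1 \<le> t" "t \<le> 1" for t
    proof -
      have "Q \<zeta> t = 0" unfolding Q_def W_def by (intro sum.neutral) auto
      then show ?thesis using p_le[of t] \<psi>(4)[of t] that t by (simp add: \<Xi>_top W_def g_def)
    qed
    show "0 \<le> Q k t1 + \<eta> * W 0 \<zeta> k t1 - \<Xi> k t1" if "k < \<zeta>" for k
    proof -
      have "Q k t1 = (\<Sum>j<\<zeta>. if j = k then real (N choose j) * t1 ^ (N - j) else 0)"
        unfolding Q_def by (intro sum.cong) (auto simp: W_def power_0_left)
      also have "\<dots> = W 0 N k t1" using that by (simp add: W_def)
      finally show ?thesis using at_t1[of k] that by simp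
    qed
  qed (use t in auto)
  moreover have "Q 0 1 = Phi (1 - t1) (\<zeta> - 1) N"
    unfolding Q_def Phi_def W_def using \<zeta>
    by (intro sum.cong) (auto simp: algebra_simps)
  ultimately have upper: "(\<Sum>m\<le>l + \<zeta>. \<alpha> m) \<le> Phi (1 - t1) (\<zeta> - 1) N + \<eta>"
    by (simp add: \<Xi>_def W_def)
  have "\<Xi> k t = (\<Sum>m\<le>l + \<zeta>. \<alpha> m * (real (m choose k) * t ^ (m - k)))" for k t
    by (simp add: \<Xi>_def W_def)
  then show ?thesis using that[of \<alpha> "l + \<zeta>", OF _ upper] lower by presburger
qed

text \<open>Weak linear programming duality: the pointwise inequalities of the dual polynomial are
  integrated against \<open>\<nu> k\<close> and summed, and the moment identities collapse the
  right-hand side to the sum of the coefficients \<open>\<alpha> m\<close>.\<close>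

lemma moment_bound:
  fixes \<nu> :: "nat \<Rightarrow> real measure" and \<epsilon> :: real
  assumes sets: "\<And>k. sets (\<nu> k) = sets borel"
    and fin: "\<And>k. finite_measure (\<nu> k)"
    and range: "\<And>k. AE t in \<nu> k. 0 \<le> t \<and> t \<le> 1"
    and moment: "\<And>m. (\<Sum>k\<le>\<zeta>. real (m choose k) * (\<integral>t. t ^ (m - k) \<partial>\<nu> k)) = 1"
    and eps: "0 < \<epsilon>" "\<epsilon> < 1" and \<zeta>: "0 < \<zeta>" "\<zeta> \<le> N"
  shows "(\<Sum>k\<le>\<zeta>. real (N choose k) * (\<integral>t. indicator {..<1 - \<epsilon>} t * t ^ (N - k) \<partial>\<nu> k))
           \<le> Phi \<epsilon> (\<zeta> - 1) N" (is "?L \<le> _")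
proof -
  note [measurable_cong] = sets
  have power_int: "integrable (\<nu> k) (\<lambda>t. t ^ m)" for k m
    by (rule finite_measure.integrable_const_bound[OF fin, where B = 1], rule eventually_mono[OF range])
      (auto simp: power_le_one)
  have ind_int: "integrable (\<nu> k) (\<lambda>t. indicator {..<1 - \<epsilon>} t * t ^ m)" for k m
    by (rule finite_measure.integrable_const_bound[OF fin, where B = 1], rule eventually_mono[OF range])
      (auto simp: power_le_one indicator_def)
  have dual_int: "integrable (\<nu> k) (\<lambda>t. \<Sum>m\<le>n. \<alpha> m * (real (m choose k) * t ^ (m - k)))"
    for k n and \<alpha> :: "nat \<Rightarrow> real"
    by (rule Bochner_Integration.integrable_sum) (simp add: power_int)
  \<comment> \<open>The cutoff needs an interval of positive length, so
    \<open>t0 = 1 - \<epsilon>\<close> is paired with some \<open>t1 = 1 - e\<close> strictly above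
    it.\<close>
  have approx: "?L \<le> Phi e (\<zeta> - 1) N + \<eta>" if e: "0 < e" "e < \<epsilon>" "0 < \<eta>" for e \<eta> :: real
  proof -
    obtain \<alpha> n where lower: "\<And>k t. k \<le> \<zeta> \<Longrightarrow> 0 \<le> t \<Longrightarrow> t \<le> 1 \<Longrightarrow>
         real (N choose k) * (indicator {..<1 - \<epsilon>} t * t ^ (N - k))
           \<le> (\<Sum>m\<le>n. \<alpha> m * (real (m choose k) * t ^ (m - k)))"
      and upper: "(\<Sum>m\<le>n. \<alpha> m) \<le> Phi (1 - (1 - e)) (\<zeta> - 1) N + \<eta>"
      by (rule dual_polynomial[of "1 - \<epsilon>" "1 - e" \<eta> \<zeta> N]) (use eps \<zeta> e in auto)
    have "?L = (\<Sum>k\<le>\<zeta>. \<integral>t. real (N choose k) * (indicator {..<1 - \<epsilon>} t * t ^ (N - k)) \<partial>\<nu> k)"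
      by simp
    also have "\<dots> \<le> (\<Sum>k\<le>\<zeta>. \<integral>t. (\<Sum>m\<le>n. \<alpha> m * (real (m choose k) * t ^ (m - k))) \<partial>\<nu> k)"
    proof (intro sum_mono integral_mono_AE)
      fix k assume "k \<in> {..\<zeta>}"
      then show "AE t in \<nu> k. real (N choose k) * (indicator {..<1 - \<epsilon>} t * t ^ (N - k))
           \<le> (\<Sum>m\<le>n. \<alpha> m * (real (m choose k) * t ^ (m - k)))"
        by (intro eventually_mono[OF range]) (auto intro: lower)
    qed (simp_all add: ind_int dual_int)
    also have "\<dots> = (\<Sum>k\<le>\<zeta>. \<Sum>m\<le>n. \<alpha> m * (real (m choose k) * (\<integral>t. t ^ (m - k) \<partial>\<nu> k)))"
      by (intro sum.cong refl) (simp add: Bochner_Integration.integral_sum power_int)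
    also have "\<dots> = (\<Sum>m\<le>n. \<alpha> m * (\<Sum>k\<le>\<zeta>. real (m choose k) * (\<integral>t. t ^ (m - k) \<partial>\<nu> k)))"
      by (subst sum.swap) (simp add: sum_distrib_left)
    also have "\<dots> = (\<Sum>m\<le>n. \<alpha> m)" by (simp add: moment)
    finally show ?thesis using upper by simp
  qed
  \<comment> \<open>First \<open>\<eta>\<close> tends to 0; then \<open>e\<close> increases to
    \<open>\<epsilon>\<close>, where \<open>Phi\<close> is continuous as a polynomial in its first
    argument.\<close>
  have "?L \<le> Phi e (\<zeta> - 1) N" if "0 < e" "e < \<epsilon>" for e
    by (rule field_le_epsilon) (rule approx[OF that])
  then have ev: "\<forall>\<^sub>F e in at_left \<epsilon>. ?L \<le> Phi e (\<zeta> - 1) N"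
    unfolding eventually_at_left[OF eps(1)] using eps(1) by blast
  have lim: "((\<lambda>e. Phi e (\<zeta> - 1) N) \<longlongrightarrow> Phi \<epsilon> (\<zeta> - 1) N) (at_left \<epsilon>)"
    unfolding Phi_def by (intro tendsto_intros)
  show ?thesis
    by (rule tendsto_lowerbound[OF lim ev]) simp
qed

section \<open>Sampling violator spaces\<close>

text \<open>The index-set counterpart of an essential set. Minimality counts indices instead of
  elements, so that permutations of the coordinates act on bases even when sample points
  repeat.\<close>

definition basis :: "('s set \<Rightarrow> 'v) \<Rightarrow> (nat \<Rightarrow> 's) \<Rightarrow> nat set \<Rightarrow> nat set \<Rightarrow> bool" where
  "basis f s J I \<longleftrightarrow> I \<subseteq> J \<and> f (s ` I) = f (s ` J) \<and>
     (\<forall>I'\<subseteq>J. f (s ` I') = f (s ` J) \<longrightarrow> card I \<le> card I')"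

definition basis_size :: "('s set \<Rightarrow> 'v) \<Rightarrow> (nat \<Rightarrow> 's) \<Rightarrow> nat set \<Rightarrow> nat" where
  "basis_size f s J = (LEAST n. \<exists>I\<subseteq>J. f (s ` I) = f (s ` J) \<and> card I = n)"

lemma basis_size_le: "I \<subseteq> J \<Longrightarrow> f (s ` I) = f (s ` J) \<Longrightarrow> basis_size f s J \<le> card I"
  unfolding basis_size_def by (rule Least_le) blast

lemma basis_iff_basis_size:
  "basis f s J I \<longleftrightarrow> I \<subseteq> J \<and> f (s ` I) = f (s ` J) \<and> card I = basis_size f s J"
proof -
  have "\<exists>I\<subseteq>J. f (s ` I) = f (s ` J) \<and> card I = basis_size f s J"
    unfolding basis_size_def by (rule LeastI[of _ "card J"]) blast
  then show ?thesis
    unfolding basis_def by (metis le_antisym basis_size_le)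
qed

lemma basis_exists: "\<exists>I. basis f s J I"
proof -
  have "\<exists>I\<subseteq>J. f (s ` I) = f (s ` J) \<and> card I = basis_size f s J"
    unfolding basis_size_def by (rule LeastI[of _ "card J"]) blast
  then show ?thesis by (auto simp: basis_iff_basis_size)
qed

lemma basis_size_eq_iff: "basis_size f s J = k \<longleftrightarrow> (\<exists>I\<in>Pow J. basis f s J I \<and> card I = k)"
  using basis_exists[of f s J] by (auto simp: basis_iff_basis_size)

text \<open>Only images of index sets and their cardinalities matter for a basis, and an injective
  relabelling respects both. This serves restrictions of samples and permutations alike.\<close>

lemma basis_reindex:
  assumes s': "\<And>n. n \<in> J \<Longrightarrow> s' n = s (t n)" and t: "inj_on t J" and I: "I \<subseteq> J"
  shows "basis f s' J I \<longleftrightarrow> basis f s (t ` J) (t ` I)"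
proof -
  have im: "s' ` K = s ` t ` K" if "K \<subseteq> J" for K
    unfolding image_image using that s' by (intro image_cong) auto
  have card: "card (t ` K) = card K" if "K \<subseteq> J" for K
    using t that by (meson card_image inj_on_subset)
  have "(\<forall>I'\<subseteq>J. f (s' ` I') = f (s' ` J) \<longrightarrow> card I \<le> card I') \<longleftrightarrow>
        (\<forall>K\<subseteq>t ` J. f (s ` K) = f (s ` t ` J) \<longrightarrow> card I \<le> card K)"
    unfolding all_subset_image using card im by auto
  moreover have "t ` I \<subseteq> t ` J" using I by blast
  ultimately show ?thesis
    using I by (simp add: basis_def im card)
qed

lemma basis_size_reindex:
  assumes s': "\<And>n. n \<in> J \<Longrightarrow> s' n = s (t n)" and t: "inj_on t J"
  shows "basis_size f s' J = basis_size f s (t ` J)"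
proof -
  obtain I where I: "basis f s' J I" using basis_exists by blast
  then have "I \<subseteq> J" by (simp add: basis_def)
  then have "basis f s (t ` J) (t ` I)" using I basis_reindex[of J s' s t I f] s' t by blast
  moreover have "card (t ` I) = card I" using \<open>I \<subseteq> J\<close> t by (meson card_image inj_on_subset)
  ultimately show ?thesis using I by (simp add: basis_iff_basis_size)
qed

section \<open>Integrals of truth values and counting of subsets\<close>

lemma borel_measurable_of_bool [measurable (raw)]:
  "Measurable.pred M R \<Longrightarrow> (\<lambda>x. of_bool (R x) :: ennreal) \<in> borel_measurable M"
  unfolding of_bool_def by measurable

lemma nn_integral_of_bool:
  "Measurable.pred M R \<Longrightarrow> (\<integral>\<^sup>+x. of_bool (R x) \<partial>M) = emeasure M {x \<in> space M. R x}"
proof -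
  assume [measurable]: "Measurable.pred M R"
  have "(\<integral>\<^sup>+x. of_bool (R x) \<partial>M) = (\<integral>\<^sup>+x. indicator {x \<in> space M. R x} x \<partial>M)"
    by (intro nn_integral_cong) (simp add: indicator_def)
  then show ?thesis by simp
qed

lemma sum_Pow_card:
  fixes g :: "nat \<Rightarrow> 'b::semiring_1"
  assumes "finite A"
  shows "(\<Sum>I\<in>Pow A. g (card I)) = (\<Sum>k\<le>card A. of_nat (card A choose k) * g k)"
proof -
  have "(\<Sum>I\<in>Pow A. g (card I)) = (\<Sum>k\<le>card A. \<Sum>I\<in>{I \<in> Pow A. card I = k}. g (card I))"
    by (rule sum.group[symmetric]) (use assms card_mono in auto)
  also have "\<dots> = (\<Sum>k\<le>card A. of_nat (card A choose k) * g k)"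
    using n_subsets[OF assms] by (intro sum.cong) (auto simp: Pow_def)
  finally show ?thesis .
qed

text \<open>An abstraction in which the cost enters through equality of values only.
  \<open>sandwich\<close> is what monotonicity leaves once the order is forgotten;
  \<open>locality\<close> reflects that a further constraint is judged by the optimal solution
  alone, which nested sets of equal cost share.\<close>

locale violator_sampling = prob_space P for P :: "'s measure" +
  fixes f :: "'s set \<Rightarrow> 'v" and \<zeta> :: nat
  assumes sandwich: "\<And>A B C. finite C \<Longrightarrow> C \<subseteq> space P \<Longrightarrow> A \<subseteq> B \<Longrightarrow> B \<subseteq> C \<Longrightarrow> f A = f C \<Longrightarrow> f B = f C"
    and locality: "\<And>A B \<delta>. finite B \<Longrightarrow> B \<subseteq> space P \<Longrightarrow> \<delta> \<in> space P \<Longrightarrow> A \<subseteq> B \<Longrightarrow> f A = f B \<Longrightarrow>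
      f (insert \<delta> A) = f A \<longleftrightarrow> f (insert \<delta> B) = f B"
    and event: "\<And>(M::nat) I. I \<subseteq> {1..M} \<Longrightarrow>
      {s \<in> space (PiM {1..M} (\<lambda>_. P)). f (s ` I) = f (s ` {1..M})} \<in> sets (PiM {1..M} (\<lambda>_. P))"
    and unique: "\<And>M. AE s in PiM {1..M} (\<lambda>_. P). \<exists>!I. basis f s {1..M} I"
    and dim: "\<And>M s I. s \<in> space (PiM {1..M} (\<lambda>_. P)) \<Longrightarrow> basis f s {1..M} I \<Longrightarrow> card I \<le> \<zeta>"
begin

section \<open>Product laws of samples and measurability of basis events\<close>

abbreviation Q :: "nat set \<Rightarrow> (nat \<Rightarrow> 's) measure" where
  "Q J \<equiv> PiM J (\<lambda>_. P)"

definition \<tau> :: "'s set \<Rightarrow> real" where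
  "\<tau> \<omega> = prob {\<delta> \<in> space P. f (insert \<delta> \<omega>) = f \<omega>}"

sublocale prod: product_sigma_finite "\<lambda>_::nat. P"
  by unfold_locales

lemma prob_space_Q: "prob_space (Q J)"
  by (rule prob_space_PiM) (rule prob_space_axioms)

lemma image_Q: "s \<in> space (Q L) \<Longrightarrow> J \<subseteq> L \<Longrightarrow> s ` J \<subseteq> space P"
  by (auto simp: space_PiM PiE_def Pi_def)

lemma reindex_measurable [measurable]:
  "t ` J \<subseteq> L \<Longrightarrow> (\<lambda>s. \<lambda>n\<in>J. s (t n)) \<in> Q L \<rightarrow>\<^sub>M Q J"
  by (intro measurable_restrict measurable_component_singleton) auto

lemma distr_reindex:
  assumes "inj_on t J" "t ` J \<subseteq> L"
  shows "distr (Q L) (Q J) (\<lambda>s. \<lambda>n\<in>J. s (t n)) = Q J"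
  by (rule distr_PiM_reindex) (use assms prob_space_axioms in auto)

lemma nn_integral_reindex:
  assumes "inj_on t J" "t ` J \<subseteq> L" "g \<in> borel_measurable (Q J)"
  shows "(\<integral>\<^sup>+s. g (\<lambda>n\<in>J. s (t n)) \<partial>Q L) = (\<integral>\<^sup>+s. g s \<partial>Q J)"
proof -
  have "integral\<^sup>N (distr (Q L) (Q J) (\<lambda>s. \<lambda>n\<in>J. s (t n))) g = (\<integral>\<^sup>+s. g (\<lambda>n\<in>J. s (t n)) \<partial>Q L)"
    by (rule nn_integral_distr) (use assms in auto)
  then show ?thesis using assms by (simp add: distr_reindex)
qed

lemma AE_reindex:
  assumes "inj_on t J" "t ` J \<subseteq> L" "AE s in Q J. R s"
  shows "AE s in Q L. R (\<lambda>n\<in>J. s (t n))"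
proof (rule AE_distrD[where M' = "Q J"])
  show "(\<lambda>s. \<lambda>n\<in>J. s (t n)) \<in> Q L \<rightarrow>\<^sub>M Q J" using assms(2) by (rule reindex_measurable)
  show "AE s in distr (Q L) (Q J) (\<lambda>s. \<lambda>n\<in>J. s (t n)). R s"
    unfolding distr_reindex[OF assms(1,2)] by fact
qed

text \<open>The assumption \<open>event\<close> covers initial index sets only; an enumeration of
  \<open>J\<close> by \<open>{1..card J}\<close> pulls it back to arbitrary coordinates.\<close>

lemma value_eq_measurable:
  assumes "finite J" "I \<subseteq> J" "J \<subseteq> L"
  shows "Measurable.pred (Q L) (\<lambda>s. f (s ` I) = f (s ` J))"
proof -
  define n where "n = card J"
  obtain t where t: "bij_betw t {1..n} J"
    using ex_bij_betw_nat_finite_1[OF assms(1)] unfolding n_def by blast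
  define I' where "I' = {i \<in> {1..n}. t i \<in> I}"
  have I': "I' \<subseteq> {1..n}" "t ` I' = I" and J: "t ` {1..n} = J"
    using t assms(2) by (auto simp: I'_def bij_betw_def)
  have *: "Measurable.pred (Q {1..n}) (\<lambda>s. f (s ` I') = f (s ` {1..n}))"
    unfolding pred_def by (rule event) (rule I'(1))
  define R where "R s = (\<lambda>i\<in>{1..n}. s (t i))" for s :: "nat \<Rightarrow> 's"
  have "R \<in> Q L \<rightarrow>\<^sub>M Q {1..n}"
    unfolding R_def[abs_def] using J assms(3) by (intro reindex_measurable) auto
  note measurable_compose[OF this *]
  moreover have "R s ` K = s ` t ` K" if "K \<subseteq> {1..n}" for s K
    unfolding image_image R_def using that by (intro image_cong) auto
  ultimately have "Measurable.pred (Q L) (\<lambda>s. f (s ` t ` I') = f (s ` t ` {1..n}))"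
    using I'(1) by (simp only: order_refl)
  then show ?thesis unfolding I'(2) J .
qed

lemma basis_measurable:
  assumes "finite J" "J \<subseteq> L"
  shows "Measurable.pred (Q L) (\<lambda>s. basis f s J I)"
proof (cases "I \<subseteq> J")
  case True
  have "basis f s J I \<longleftrightarrow> f (s ` I) = f (s ` J) \<and>
      (\<forall>I'\<in>Pow J. f (s ` I') = f (s ` J) \<longrightarrow> card I \<le> card I')" for s
    using True by (auto simp: basis_def)
  moreover have [measurable]: "Measurable.pred (Q L) (\<lambda>s. f (s ` I') = f (s ` J))"
    if "I' \<in> Pow J" for I' using that assms by (intro value_eq_measurable) auto
  ultimately show ?thesis using True assms(1)
    by (simp only:) (intro pred_intros_logic pred_intros_finite; use assms in measurable)
qed (simp add: basis_def)

lemma basis_size_measurable: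
  assumes "finite J" "J \<subseteq> L"
  shows "Measurable.pred (Q L) (\<lambda>s. basis_size f s J = k)"
  unfolding basis_size_eq_iff using assms
  by (intro pred_intros_finite pred_intros_logic basis_measurable) auto

text \<open>A fresh index \<open>j\<close> turns the additional constraint into one more coordinate,
  so that \<open>\<tau>\<close> becomes the measure of a section of a jointly measurable
  event.\<close>

lemma \<tau>_measurable:
  assumes "finite J" "J \<subseteq> L"
  shows "(\<lambda>s. \<tau> (s ` J)) \<in> borel_measurable (Q L)"
proof -
  obtain j where j: "j \<notin> J" using assms(1) ex_new_if_finite infinite_UNIV_nat by blast
  have [measurable]: "Measurable.pred (Q (insert j J)) (\<lambda>s. f (s ` J) = f (s ` insert j J))"
    by (rule value_eq_measurable) (use assms in auto)
  define Z where "Z = {x \<in> space (Q J \<Otimes>\<^sub>M P).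
      f ((\<lambda>(s, \<delta>). s(j := \<delta>)) x ` J) = f ((\<lambda>(s, \<delta>). s(j := \<delta>)) x ` insert j J)}"
  have "Z \<in> sets (Q J \<Otimes>\<^sub>M P)" unfolding Z_def by measurable
  then have "(\<lambda>s. emeasure P (Pair s -` Z)) \<in> borel_measurable (Q J)"
    by (rule measurable_emeasure_Pair)
  moreover have "Pair s -` Z = {\<delta> \<in> space P. f (insert \<delta> (s ` J)) = f (s ` J)}" if "s \<in> space (Q J)" for s
  proof -
    have "s(j := \<delta>) ` J = s ` J" for \<delta> using j by (intro image_cong) auto
    then show ?thesis using that by (auto simp: Z_def space_pair_measure)
  qed
  ultimately have "(\<lambda>s. \<tau> (s ` J)) \<in> borel_measurable (Q J)"
    unfolding \<tau>_def measure_def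
    by (subst measurable_cong[where g = "\<lambda>s. enn2real (emeasure P (Pair s -` Z))"]) auto
  from measurable_compose[OF measurable_restrict_subset[OF assms(2)] this]
  show ?thesis by simp
qed

lemma sat_measurable:
  assumes "finite J" "J \<subseteq> L" "i \<in> L"
  shows "Measurable.pred (Q L) (\<lambda>s. f (insert (s i) (s ` J)) = f (s ` J))"
  using value_eq_measurable[of "insert i J" J L] assms by (simp add: eq_commute subset_insertI)

lemma sat_event:
  assumes "finite J" "s \<in> space (Q J)"
  shows "{\<delta> \<in> space P. f (insert \<delta> (s ` J)) = f (s ` J)} \<in> events"
proof -
  obtain j where j: "j \<notin> J" using assms(1) ex_new_if_finite infinite_UNIV_nat by blast
  have upd: "(\<lambda>\<delta>. s(j := \<delta>)) \<in> P \<rightarrow>\<^sub>M Q (insert j J)"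
    by (rule measurable_fun_upd[where J = J and f = "\<lambda>_. s"]) (use assms(2) in auto)
  have "Measurable.pred P (\<lambda>\<delta>. f (insert ((s(j := \<delta>)) j) (s(j := \<delta>) ` J)) = f (s(j := \<delta>) ` J))"
    by (rule measurable_compose[OF upd sat_measurable]) (use assms in auto)
  moreover have "s(j := \<delta>) ` J = s ` J" for \<delta> using j by (intro image_cong) auto
  ultimately show ?thesis by (simp add: pred_def)
qed

lemma nn_integral_sat:
  assumes "finite J" "s \<in> space (Q J)"
  shows "(\<integral>\<^sup>+\<delta>. of_bool (f (insert \<delta> (s ` J)) = f (s ` J)) \<partial>P) = ennreal (\<tau> (s ` J))"
  using sat_event[OF assms] by (simp add: nn_integral_of_bool \<tau>_def emeasure_eq_measure pred_def)

text \<open>Non-degeneracy only speaks about bases of minimal cardinality, so one has to exclude that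
  a further sample which leaves the value unchanged creates a smaller basis. If this drop to
  size \<open>j\<close> had positive probability, then by Fubini it would happen for two independent
  copies of the further sample at once. With both copies present, two distinct bases of size \<open>j\<close>
  would contradict uniqueness, so the basis size drops below \<open>j\<close>, and the induction
  hypothesis applies.\<close>

lemma basis_size_mono_AE:
  "AE s in Q {1..Suc m}. f (s ` {1..m}) = f (s ` {1..Suc m}) \<longrightarrow>
     basis_size f s {1..m} \<le> basis_size f s {1..Suc m}"
proof -
  have "AE s in Q {1..Suc m}. f (s ` {1..m}) = f (s ` {1..Suc m}) \<and> basis_size f s {1..m} = k \<longrightarrow>
      k \<le> basis_size f s {1..Suc m}" for k
  \<comment> \<open>The hypothesis is needed for the smaller size \<open>j\<close> at
    \<open>Suc m\<close> in place of \<open>m\<close>.\<close>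
  proof (induction k arbitrary: m rule: less_induct)
    case (less k)
    define J0 J1 J2 where "J0 = {1..m}" and "J1 = {1..Suc m}" and "J2 = {1..Suc (Suc m)}"
    have J: "finite J0" "finite J1" "finite J2" "J1 = insert (Suc m) J0" "Suc m \<notin> J0"
      "J2 = insert (Suc (Suc m)) J1" "Suc (Suc m) \<notin> J1" "J0 \<subseteq> J1" "J1 \<subseteq> J2" "J0 \<subseteq> J2" "J1 \<subseteq> J1"
      by (auto simp: J0_def J1_def J2_def)
    have "AE s in Q J1. \<not> (f (s ` J0) = f (s ` J1) \<and> basis_size f s J0 = k \<and> basis_size f s J1 = j)"
      if "j < k" for j
    proof -
      define D where "D s \<longleftrightarrow> f (s ` J0) = f (s ` J1) \<and> basis_size f s J0 = k \<and> basis_size f s J1 = j" for s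
      have D_meas [measurable]: "Measurable.pred (Q J1) D"
        unfolding D_def[abs_def] using J
        by (intro pred_intros_logic value_eq_measurable basis_size_measurable) auto
      \<comment> \<open>\<open>p s\<close> and \<open>q s\<close> share the first \<open>m\<close>
        points of a sample of size \<open>Suc (Suc m)\<close>; they differ in which of its last two
        points serves as the additional one.\<close>
      define t where "t n = (if n = Suc m then Suc (Suc m) else n)" for n :: nat
      have t: "inj_on t J1" "t ` J1 \<subseteq> J2" "t ` J0 = J0" "t ` J1 = insert (Suc (Suc m)) J0" "inj_on t J0"
        using J by (auto simp: t_def inj_on_def J0_def J1_def J2_def)
      define p q where "p s = (\<lambda>n\<in>J1. s n)" and "q s = (\<lambda>n\<in>J1. s (t n))" for s :: "nat \<Rightarrow> 's"
      have p_eq: "p s ` K = s ` K" if "K \<subseteq> J1" for s K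
        unfolding p_def using that by (intro image_cong) auto
      have q_eq: "q s ` K = s ` t ` K" if "K \<subseteq> J1" for s K
        unfolding q_def image_image using that by (intro image_cong) auto
      have p_size: "basis_size f (p s) K = basis_size f s K" if "K \<subseteq> J1" for s K
        using that basis_size_reindex[of K "p s" s "\<lambda>n. n" f] by (simp add: p_def subset_iff)
      have q_size: "basis_size f (q s) K = basis_size f s (t ` K)" if "K \<subseteq> J1" for s K
        using that inj_on_subset[OF t(1) that] basis_size_reindex[of K "q s" s t f] by (simp add: q_def subset_iff)
      have pq_meas: "p \<in> Q J2 \<rightarrow>\<^sub>M Q J1" "q \<in> Q J2 \<rightarrow>\<^sub>M Q J1"
        unfolding p_def[abs_def] q_def[abs_def] using t(2) J(9)
        by (auto intro!: reindex_measurable measurable_restrict_subset)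
      note [measurable] = measurable_compose[OF pq_meas(1) D_meas] measurable_compose[OF pq_meas(2) D_meas]
      have null: "AE s in Q J2. \<not> (D (p s) \<and> D (q s))"
        using unique[of "Suc (Suc m)"] less.IH[OF that, of "Suc m"] AE_space[of "Q J2"]
        unfolding J1_def[symmetric] J2_def[symmetric]
      proof eventually_elim
        case (elim s)
        show ?case
        proof
          assume "D (p s) \<and> D (q s)"
          then have D: "f (s ` J0) = f (s ` J1)" "basis_size f s J0 = k" "basis_size f s J1 = j"
            "f (s ` J0) = f (s ` t ` J1)" "basis_size f s (t ` J1) = j"
            by (auto simp: D_def p_eq[OF J(8)] p_eq[OF J(11)] q_eq[OF J(8)] q_eq[OF J(11)]
                p_size[OF J(8)] p_size[OF J(11)] q_size[OF J(8)] q_size[OF J(11)] t(3))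
          \<comment> \<open>The second additional point is harmless to \<open>J0\<close>, and
            locality carries this over to \<open>J1\<close>.\<close>
          have "f (insert (s (Suc (Suc m))) (s ` J1)) = f (s ` J1)"
          proof (rule iffD1[OF locality[OF _ _ _ _ D(1)]])
            show "f (insert (s (Suc (Suc m))) (s ` J0)) = f (s ` J0)" using D(4) by (simp add: t(4))
            show "s ` J1 \<subseteq> space P" by (rule image_Q[OF elim(3) J(9)])
            show "s (Suc (Suc m)) \<in> space P" using image_Q[OF elim(3) order_refl] by (auto simp: J(6))
            show "s ` J0 \<subseteq> s ` J1" using J(8) by blast
          qed (simp add: J(2))
          then have J2: "f (s ` J2) = f (s ` J1)" by (simp add: J(6))
          then have j: "j \<le> basis_size f s J2" using elim(2) D(3) by simp
          obtain I I' where I: "basis f s J1 I" and I': "basis f s (t ` J1) I'"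
            using basis_exists by blast
          have B: "basis f s J2 K" if "K \<subseteq> J2" "f (s ` K) = f (s ` J2)" "card K = j" for K
            using that j basis_size_le[of K J2 f s] by (auto simp: basis_iff_basis_size)
          have "I \<subseteq> J2" "I' \<subseteq> J2" using I I' J(9) t(2) by (auto simp: basis_def)
          moreover have "f (s ` I) = f (s ` J2)" "f (s ` I') = f (s ` J2)" "card I = j" "card I' = j"
            using I I' D J2 by (auto simp: basis_iff_basis_size)
          ultimately have "basis f s J2 I" "basis f s J2 I'" by (auto intro: B)
          then have "I = I'" using elim(1) by blast
          \<comment> \<open>The index sets of the two copies meet in \<open>J0\<close> only. A
            common basis was thus available before the additional point, with size
            \<open>j < k\<close>.\<close>
          then have "I \<subseteq> J0" using I I' t(4) J(4,6,7) by (auto simp: basis_iff_basis_size)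
          then have "basis_size f s J0 \<le> card I" using I D(1) by (intro basis_size_le) (auto simp: basis_iff_basis_size)
          then show False using I D that by (simp add: basis_iff_basis_size)
        qed
      qed
      \<comment> \<open>The conditional probability of the drop given the first \<open>m\<close>
        points. The two copies are conditionally independent, so the null event just found has
        probability equal to the integral of \<open>W * W\<close>, which forces \<open>W\<close> to
        vanish almost everywhere.\<close>
      define W where "W x = (\<integral>\<^sup>+y. of_bool (D (x(Suc m := y))) \<partial>P)" for x
      have upd: "(\<lambda>(x, y). x(Suc m := y)) \<in> Q J0 \<Otimes>\<^sub>M P \<rightarrow>\<^sub>M Q J1"
        unfolding J(4) by (rule measurable_add_dim)
      have W_meas [measurable]: "W \<in> borel_measurable (Q J0)"
        unfolding W_def[abs_def] by (rule borel_measurable_nn_integral)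
          (use measurable_compose[OF upd D_meas] in \<open>simp add: case_prod_beta'\<close>)
      have upd_x: "(\<lambda>y. x(Suc m := y)) \<in> P \<rightarrow>\<^sub>M Q J1" if "x \<in> space (Q J0)" for x
        by (rule measurable_fun_upd[where J = J0 and f = "\<lambda>_. x"]) (use that J in auto)
      have "0 = (\<integral>\<^sup>+s. of_bool (D (p s)) * of_bool (D (q s)) \<partial>Q J2)"
        by (rule sym, subst nn_integral_0_iff_AE) (use null in auto)
      also have "\<dots> = (\<integral>\<^sup>+x. \<integral>\<^sup>+z. of_bool (D (p (x(Suc (Suc m) := z)))) *
          of_bool (D (q (x(Suc (Suc m) := z)))) \<partial>P \<partial>Q J1)"
      proof -
        have "(\<lambda>s. of_bool (D (p s)) * of_bool (D (q s)) :: ennreal) \<in> borel_measurable (Q J2)"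
          by measurable
        then show ?thesis unfolding J(6) by (rule prod.product_nn_integral_insert[OF J(2,7)])
      qed
      also have "\<dots> = (\<integral>\<^sup>+x. of_bool (D x) * W (restrict x J0) \<partial>Q J1)"
      proof (intro nn_integral_cong)
        fix x assume x: "x \<in> space (Q J1)"
        then have r: "restrict x J0 \<in> space (Q J0)"
          using J(8) by (auto simp: space_PiM)
        have "p (x(Suc (Suc m) := z)) = x" for z
          using x J(7) by (auto simp: p_def space_PiM fun_eq_iff PiE_def extensional_def)
        moreover have "q (x(Suc (Suc m) := z)) = (restrict x J0)(Suc m := z)" for z
          using x J by (auto simp: q_def t_def fun_eq_iff)
        moreover have "(\<lambda>z. of_bool (D ((restrict x J0)(Suc m := z))) :: ennreal) \<in> borel_measurable P"
          using measurable_compose[OF upd_x[OF r] D_meas] by measurable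
        ultimately show "(\<integral>\<^sup>+z. of_bool (D (p (x(Suc (Suc m) := z)))) *
            of_bool (D (q (x(Suc (Suc m) := z)))) \<partial>P) = of_bool (D x) * W (restrict x J0)"
          by (simp add: W_def nn_integral_cmult)
      qed
      also have "\<dots> = (\<integral>\<^sup>+x. \<integral>\<^sup>+y. of_bool (D (x(Suc m := y))) * W (restrict (x(Suc m := y)) J0) \<partial>P \<partial>Q J0)"
      proof -
        have "(\<lambda>x. of_bool (D x) * W (restrict x J0)) \<in> borel_measurable (Q J1)"
          using measurable_compose[OF measurable_restrict_subset[OF J(8)] W_meas] by measurable
        then show ?thesis unfolding J(4) by (intro prod.product_nn_integral_insert J)
      qed
      also have "\<dots> = (\<integral>\<^sup>+x. W x * W x \<partial>Q J0)"
      proof (intro nn_integral_cong)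
        fix x assume x: "x \<in> space (Q J0)"
        have "restrict (x(Suc m := y)) J0 = x" for y
          using x J(5) by (auto simp: space_PiM fun_eq_iff PiE_def extensional_def)
        moreover have "(\<lambda>y. of_bool (D (x(Suc m := y))) :: ennreal) \<in> borel_measurable P"
          using measurable_compose[OF upd_x[OF x] D_meas] by measurable
        ultimately show "(\<integral>\<^sup>+y. of_bool (D (x(Suc m := y))) * W (restrict (x(Suc m := y)) J0) \<partial>P) = W x * W x"
          by (simp add: nn_integral_multc) (simp add: W_def)
      qed
      finally have "(\<integral>\<^sup>+x. W x * W x \<partial>Q J0) = 0" by simp
      then have "AE x in Q J0. W x = 0"
        by (subst (asm) nn_integral_0_iff_AE) auto
      then have "(\<integral>\<^sup>+x. W x \<partial>Q J0) = 0"
        by (subst nn_integral_0_iff_AE) auto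
      moreover have "(\<integral>\<^sup>+s. of_bool (D s) \<partial>Q J1) = (\<integral>\<^sup>+x. W x \<partial>Q J0)"
      proof -
        have "(\<lambda>x. of_bool (D x) :: ennreal) \<in> borel_measurable (Q J1)" by measurable
        then show ?thesis unfolding J(4) W_def by (intro prod.product_nn_integral_insert J)
      qed
      ultimately have "AE s in Q J1. of_bool (D s) = (0 :: ennreal)"
        by (subst nn_integral_0_iff_AE[symmetric]) auto
      then show ?thesis by (auto simp: D_def)
    qed
    then have "AE s in Q J1. \<forall>j\<in>{..<k}. \<not> (f (s ` J0) = f (s ` J1) \<and> basis_size f s J0 = k \<and> basis_size f s J1 = j)"
      by (intro AE_finite_allI) auto
    then show ?case unfolding J0_def J1_def by eventually_elim (auto simp: not_less[symmetric])
  qed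
  then have "AE s in Q {1..Suc m}. \<forall>k. f (s ` {1..m}) = f (s ` {1..Suc m}) \<and> basis_size f s {1..m} = k \<longrightarrow>
      k \<le> basis_size f s {1..Suc m}" by (subst AE_all_countable) blast
  then show ?thesis by eventually_elim auto
qed

text \<open>Points are added one at a time. If \<open>{1..k}\<close> remains a basis,
  \<open>sandwich\<close> shows that no point in between changes the value. Conversely,
  \<open>locality\<close> keeps the value when a harmless point is added, and almost surely no
  smaller basis arises by \<open>basis_size_mono_AE\<close>.\<close>

lemma basis_extend_AE:
  "AE s in Q {1..k + n}. basis f s {1..k + n} {1..k} \<longleftrightarrow> basis f s {1..k} {1..k} \<and>
     (\<forall>i\<in>{k+1..k+n}. f (insert (s i) (s ` {1..k})) = f (s ` {1..k}))"
proof (induction n)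
  case 0
  then show ?case by simp
next
  case (Suc n)
  define K J J' where "K = {1..k}" and "J = {1..k + n}" and "J' = {1..Suc (k + n)}"
  have sub: "K \<subseteq> J" "J \<subseteq> J'" "J' = insert (Suc (k + n)) J" "finite J'" "finite J"
    by (auto simp: K_def J_def J'_def)
  define R where "R s \<longleftrightarrow> (basis f s J K \<longleftrightarrow> basis f s K K \<and>
      (\<forall>i\<in>{k+1..k+n}. f (insert (s i) (s ` K)) = f (s ` K)))" for s
  have "AE s in Q J. R s"
    unfolding R_def using Suc.IH unfolding K_def J_def .
  then have "AE s in Q J'. R (\<lambda>i\<in>J. s i)"
    by (intro AE_reindex) (use sub(2) in auto)
  moreover have "AE s in Q J'. f (s ` J) = f (s ` J') \<longrightarrow> basis_size f s J \<le> basis_size f s J'"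
    unfolding J_def J'_def by (rule basis_size_mono_AE)
  moreover have "AE s in Q J'. s \<in> space (Q J')" by (rule AE_space)
  ultimately have "AE s in Q J'. basis f s J' K \<longleftrightarrow> basis f s K K \<and>
     (\<forall>i\<in>{k+1..k+Suc n}. f (insert (s i) (s ` K)) = f (s ` K))"
  proof eventually_elim
    case (elim s)
    have r: "(\<lambda>i\<in>J. s i) ` L = s ` L" if "L \<subseteq> J" for L
      using that by (intro image_cong) auto
    have "basis f (\<lambda>i\<in>J. s i) J K = basis f s J K" "basis f (\<lambda>i\<in>J. s i) K K = basis f s K K"
      using basis_reindex[of J "\<lambda>i\<in>J. s i" s "\<lambda>i. i" K f]
        basis_reindex[of K "\<lambda>i\<in>J. s i" s "\<lambda>i. i" K f] sub(1) by (simp_all add: subset_iff)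
    moreover have "(\<lambda>i\<in>J. s i) i = s i" if "i \<in> {k+1..k+n}" for i
      using that by (simp add: J_def)
    ultimately have IH: "basis f s J K \<longleftrightarrow> basis f s K K \<and>
        (\<forall>i\<in>{k+1..k+n}. f (insert (s i) (s ` K)) = f (s ` K))"
      using elim(1) r[OF sub(1)] unfolding R_def by simp
    have sp: "s ` J' \<subseteq> space P" "s ` J \<subseteq> space P" "s (Suc (k + n)) \<in> space P"
      using image_Q[OF elim(3), of J'] sub by auto
    let ?sat = "f (insert (s (Suc (k + n))) (s ` K)) = f (s ` K)"
    have "basis f s J' K \<longleftrightarrow> basis f s J K \<and> ?sat"
    proof
      assume B: "basis f s J' K"
      then have eq: "f (s ` K) = f (s ` J')" by (simp add: basis_def)
      have "f (s ` J) = f (s ` J')"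
        by (rule sandwich[OF _ sp(1) image_mono[OF sub(1)] image_mono[OF sub(2)] eq]) (simp add: sub)
      moreover have "f (insert (s (Suc (k + n))) (s ` K)) = f (s ` J')"
        by (rule sandwich[OF _ sp(1) _ _ eq]) (use sub in auto)
      ultimately show "basis f s J K \<and> ?sat"
        using B sub eq by (auto simp: basis_def)
    next
      assume B: "basis f s J K \<and> ?sat"
      then have eq: "f (s ` K) = f (s ` J)" by (simp add: basis_def)
      have "f (insert (s (Suc (k + n))) (s ` J)) = f (s ` J)"
        using locality[OF _ sp(2,3) image_mono[OF sub(1)] eq] sub B by simp
      then have eq': "f (s ` J') = f (s ` J)" using sub(3) by simp
      then have "card K \<le> basis_size f s J'" using elim(2) B by (simp add: basis_iff_basis_size)
      moreover have "basis_size f s J' \<le> card K"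
        using sub eq eq' by (intro basis_size_le) auto
      ultimately show "basis f s J' K"
        using sub eq eq' by (auto simp: basis_iff_basis_size)
    qed
    moreover have "{k+1..k+Suc n} = insert (Suc (k + n)) {k+1..k+n}" by auto
    ultimately show ?case using IH by auto
  qed
  then show ?case unfolding K_def J'_def add_Suc_right .
qed

text \<open>Given the first \<open>k\<close> points, the other \<open>n\<close> are independent, and
  each is harmless with probability \<open>\<tau>\<close>. The induction varies \<open>h\<close>
  because integrating out the last point multiplies it by \<open>\<tau>\<close>.\<close>

lemma nn_integral_sat_power:
  assumes [measurable]: "h \<in> borel_measurable (Q {1..k})"
  shows "(\<integral>\<^sup>+s. h (restrict s {1..k}) *
            of_bool (\<forall>i\<in>{k+1..k+n}. f (insert (s i) (s ` {1..k})) = f (s ` {1..k})) \<partial>Q {1..k + n})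
         = (\<integral>\<^sup>+s. h s * ennreal (\<tau> (s ` {1..k})) ^ n \<partial>Q {1..k})"
  using assms
proof (induction n arbitrary: h)
  case 0
  have "restrict s {1..k} = s" if "s \<in> space (Q {1..k})" for s
    using that by (auto simp: space_PiM PiE_def extensional_restrict)
  then have "h (restrict s {1..k}) *
            of_bool (\<forall>i\<in>{k+1..k+0}. f (insert (s i) (s ` {1..k})) = f (s ` {1..k}))
      = h s * ennreal (\<tau> (s ` {1..k})) ^ 0" if "s \<in> space (Q {1..k})" for s
    using that by (simp del: One_nat_def)
  then show ?case unfolding add_0_right by (intro nn_integral_cong)
next
  case (Suc n)
  define K J where "K = {1..k}" and "J = {1..k + n}"
  let ?l = "Suc (k + n)"
  have sub: "K \<subseteq> J" "?l \<notin> J" "?l \<notin> K" "finite J" "finite K" "{1..k + Suc n} = insert ?l J"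
    "{k+1..k+Suc n} = insert ?l {k+1..k+n}" "{k+1..k+n} \<subseteq> J"
    by (auto simp: K_def J_def)
  define sat where "sat s i \<longleftrightarrow> f (insert (s i) (s ` K)) = f (s ` K)" for s :: "nat \<Rightarrow> 's" and i
  have sat_meas: "Measurable.pred (Q L) (\<lambda>s. sat s i)" if "K \<subseteq> L" "i \<in> L" for L i
    unfolding sat_def using that sub by (intro sat_measurable) auto
  have all_meas: "Measurable.pred (Q L) (\<lambda>s. \<forall>i\<in>{k+1..k+n}. sat s i)" if "J \<subseteq> L" for L
    using that sub by (intro pred_intros_finite sat_meas) auto
  have h_meas: "(\<lambda>s. h (restrict s K)) \<in> borel_measurable (Q L)" if "K \<subseteq> L" for L
    using measurable_compose[OF measurable_restrict_subset[OF that] Suc.prems[folded K_def]] .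
  have "(\<lambda>s. h (restrict s K) * (of_bool (\<forall>i\<in>{k+1..k+n}. sat s i) * of_bool (sat s ?l)))
      \<in> borel_measurable (Q (insert ?l J))"
    by (intro borel_measurable_times_ennreal borel_measurable_of_bool h_meas all_meas sat_meas) (use sub in auto)
  then have "(\<integral>\<^sup>+s. h (restrict s K) * (of_bool (\<forall>i\<in>{k+1..k+n}. sat s i) * of_bool (sat s ?l)) \<partial>Q (insert ?l J))
      = (\<integral>\<^sup>+x. \<integral>\<^sup>+y. h (restrict (x(?l := y)) K) *
          (of_bool (\<forall>i\<in>{k+1..k+n}. sat (x(?l := y)) i) * of_bool (sat (x(?l := y)) ?l)) \<partial>P \<partial>Q J)"
    by (rule prod.product_nn_integral_insert[OF sub(4,2)])
  also have "\<dots> = (\<integral>\<^sup>+x. h (restrict x K) * ennreal (\<tau> (restrict x K ` K)) *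
      of_bool (\<forall>i\<in>{k+1..k+n}. sat x i) \<partial>Q J)"
  proof (intro nn_integral_cong)
    fix x assume x: "x \<in> space (Q J)"
    have r: "restrict x K ` K = x ` K" by (intro image_cong) auto
    have xK: "restrict x K \<in> space (Q K)" using x sub(1) by (auto simp: space_PiM)
    have 1: "restrict (x(?l := y)) K = restrict x K" for y using sub(3) by (auto simp: fun_eq_iff)
    have 2: "x(?l := y) ` K = x ` K" for y using sub(3) by (intro image_cong) auto
    have 3: "(\<forall>i\<in>{k+1..k+n}. sat (x(?l := y)) i) = (\<forall>i\<in>{k+1..k+n}. sat x i)" for y
      unfolding sat_def 2 by (intro ball_cong) (use sub in auto)
    have 4: "sat (x(?l := y)) ?l \<longleftrightarrow> f (insert y (x ` K)) = f (x ` K)" for y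
      unfolding sat_def 2 by simp
    have "(\<lambda>y. x(?l := y)) \<in> P \<rightarrow>\<^sub>M Q (insert ?l J)"
      by (rule measurable_fun_upd[where J = J and f = "\<lambda>_. x"]) (use x in auto)
    from measurable_compose[OF this sat_meas[of "insert ?l J" ?l]] sub(1)
    have [measurable]: "Measurable.pred P (\<lambda>y. f (insert y (x ` K)) = f (x ` K))"
      unfolding sat_def 2 by (simp add: subset_insertI2)
    have "(\<integral>\<^sup>+y. of_bool (f (insert y (x ` K)) = f (x ` K)) \<partial>P) = ennreal (\<tau> (x ` K))"
      using nn_integral_sat[OF sub(5) xK] unfolding r .
    then show "(\<integral>\<^sup>+y. h (restrict (x(?l := y)) K) *
          (of_bool (\<forall>i\<in>{k+1..k+n}. sat (x(?l := y)) i) * of_bool (sat (x(?l := y)) ?l)) \<partial>P)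
        = h (restrict x K) * ennreal (\<tau> (restrict x K ` K)) * of_bool (\<forall>i\<in>{k+1..k+n}. sat x i)"
      unfolding 1 3 4 r by (simp add: nn_integral_cmult mult_ac)
  qed
  also have "\<dots> = (\<integral>\<^sup>+s. h s * ennreal (\<tau> (s ` K)) * ennreal (\<tau> (s ` K)) ^ n \<partial>Q K)"
    unfolding sat_def K_def J_def
    by (rule Suc.IH) (use Suc.prems \<tau>_measurable[of K K] sub in \<open>simp add: K_def\<close>)
  moreover have "(of_bool (\<forall>i\<in>insert ?l {k+1..k+n}. sat s i) :: ennreal) =
      of_bool (\<forall>i\<in>{k+1..k+n}. sat s i) * of_bool (sat s ?l)" for s
    by (auto simp: of_bool_def)
  ultimately show ?case
    unfolding sub(6,7) K_def[symmetric] sat_def[symmetric] power_Suc mult.assoc by (simp only:)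
qed

section \<open>Decomposition of the sample law by size of the basis\<close>

definition full where "full k s \<longleftrightarrow> basis f s {1..k} {1..k}"

lemma full_measurable [measurable]: "Measurable.pred (Q {1..k}) (full k)"
  unfolding full_def[abs_def] by (rule basis_measurable) auto

lemma \<tau>_initial_measurable [measurable]: "(\<lambda>s. \<tau> (s ` {1..k})) \<in> borel_measurable (Q {1..k})"
  by (rule \<tau>_measurable) auto

lemma \<tau>_eq:
  assumes "finite B" "B \<subseteq> space P" "A \<subseteq> B" "f A = f B"
  shows "\<tau> A = \<tau> B"
  unfolding \<tau>_def using locality[OF assms(1,2) _ assms(3,4)] by (intro arg_cong[where f = prob]) auto

text \<open>On the event that \<open>{1..k}\<close> is a basis, the whole sample and its first
  \<open>k\<close> points have the same \<open>\<tau>\<close>. Hence the later points enter only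
  through being harmless, which contributes the power of \<open>\<tau>\<close>.\<close>

lemma nn_integral_basis_initial:
  fixes \<phi> :: "real \<Rightarrow> ennreal"
  assumes [measurable]: "\<phi> \<in> borel_measurable borel" and "k \<le> M"
  shows "(\<integral>\<^sup>+s. of_bool (basis f s {1..M} {1..k}) * \<phi> (\<tau> (s ` {1..M})) \<partial>Q {1..M})
       = (\<integral>\<^sup>+s. of_bool (full k s) * \<phi> (\<tau> (s ` {1..k})) * ennreal (\<tau> (s ` {1..k})) ^ (M - k) \<partial>Q {1..k})"
proof -
  define n where "n = M - k"
  have M: "M = k + n" using assms(2) by (simp add: n_def)
  let ?h = "\<lambda>s. of_bool (full k s) * \<phi> (\<tau> (s ` {1..k}))"
  have "(\<integral>\<^sup>+s. of_bool (basis f s {1..M} {1..k}) * \<phi> (\<tau> (s ` {1..M})) \<partial>Q {1..M})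
     = (\<integral>\<^sup>+s. ?h (restrict s {1..k}) *
            of_bool (\<forall>i\<in>{k+1..k+n}. f (insert (s i) (s ` {1..k})) = f (s ` {1..k})) \<partial>Q {1..M})"
  proof (rule nn_integral_cong_AE)
    show "AE s in Q {1..M}. of_bool (basis f s {1..M} {1..k}) * \<phi> (\<tau> (s ` {1..M})) =
        ?h (restrict s {1..k}) *
            of_bool (\<forall>i\<in>{k+1..k+n}. f (insert (s i) (s ` {1..k})) = f (s ` {1..k}))"
      using basis_extend_AE[of k n] AE_space[of "Q {1..M}"] unfolding M[symmetric]
    proof eventually_elim
      case (elim s)
      have "full k (restrict s {1..k}) \<longleftrightarrow> basis f s {1..k} {1..k}"
        unfolding full_def using basis_reindex[of "{1..k}" "restrict s {1..k}" s "\<lambda>i. i" "{1..k}" f] by simp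
      moreover have "restrict s {1..k} ` {1..k} = s ` {1..k}" by (intro image_cong) auto
      moreover have "\<tau> (s ` {1..M}) = \<tau> (s ` {1..k})" if "basis f s {1..M} {1..k}"
        by (rule \<tau>_eq[symmetric])
          (use that image_Q[OF elim(2)] assms(2) in \<open>auto simp: basis_def\<close>)
      ultimately show ?case using elim(1) by (auto simp: of_bool_def)
    qed
  qed
  also have "\<dots> = (\<integral>\<^sup>+s. ?h s * ennreal (\<tau> (s ` {1..k})) ^ n \<partial>Q {1..k})"
    unfolding M by (rule nn_integral_sat_power) measurable
  finally show ?thesis by (simp add: n_def)
qed

text \<open>Exchangeability: a permutation of \<open>{1..M}\<close> taking
  \<open>{1..card I}\<close> onto \<open>I\<close> preserves both the product law and the set of
  sample points.\<close>

lemma nn_integral_basis: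
  fixes \<phi> :: "real \<Rightarrow> ennreal"
  assumes [measurable]: "\<phi> \<in> borel_measurable borel" and I: "I \<subseteq> {1..M}"
  shows "(\<integral>\<^sup>+s. of_bool (basis f s {1..M} I) * \<phi> (\<tau> (s ` {1..M})) \<partial>Q {1..M})
       = (\<integral>\<^sup>+s. of_bool (basis f s {1..M} {1..card I}) * \<phi> (\<tau> (s ` {1..M})) \<partial>Q {1..M})"
proof -
  define k where "k = card I"
  have fin: "finite I" by (rule finite_subset[OF I]) simp
  have k: "k \<le> M" using card_mono[OF _ I] by (simp add: k_def)
  obtain t1 where t1: "bij_betw t1 {1..k} I"
    using ex_bij_betw_nat_finite_1[OF fin] unfolding k_def by blast
  have "card ({1..M} - {1..k}) = card ({1..M} - I)"
    using I k fin by (subst (1 2) card_Diff_subset) (auto simp: k_def)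
  then obtain t2 where t2: "bij_betw t2 ({1..M} - {1..k}) ({1..M} - I)"
    using finite_same_card_bij[of "{1..M} - {1..k}" "{1..M} - I"] by blast
  define t where "t i = (if i \<in> {1..k} then t1 i else t2 i)" for i
  have "bij_betw t ({1..k} \<union> ({1..M} - {1..k})) (I \<union> ({1..M} - I))"
    unfolding t_def[abs_def] by (rule bij_betw_disjoint_Un[OF t1 t2]) auto
  moreover have "{1..k} \<union> ({1..M} - {1..k}) = {1..M}" "I \<union> ({1..M} - I) = {1..M}" using k I by auto
  ultimately have bij: "bij_betw t {1..M} {1..M}" by simp
  then have inj: "inj_on t {1..M}" and im: "t ` {1..M} = {1..M}" by (auto simp: bij_betw_def)
  have tI: "t ` {1..k} = I" using t1 by (auto simp: t_def bij_betw_def)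
  have "(\<lambda>s. of_bool (basis f s {1..M} {1..k}) * \<phi> (\<tau> (s ` {1..M}))) \<in> borel_measurable (Q {1..M})"
    by (intro borel_measurable_times_ennreal borel_measurable_of_bool basis_measurable
        measurable_compose[OF \<tau>_initial_measurable assms(1)] finite_atLeastAtMost order_refl)
  from nn_integral_reindex[OF inj _ this, of "{1..M}"] im
  have "(\<integral>\<^sup>+s. of_bool (basis f s {1..M} {1..k}) * \<phi> (\<tau> (s ` {1..M})) \<partial>Q {1..M}) =
      (\<integral>\<^sup>+s. of_bool (basis f (\<lambda>n\<in>{1..M}. s (t n)) {1..M} {1..k}) *
          \<phi> (\<tau> ((\<lambda>n\<in>{1..M}. s (t n)) ` {1..M})) \<partial>Q {1..M})" by simp
  also have "\<dots> = (\<integral>\<^sup>+s. of_bool (basis f s {1..M} I) * \<phi> (\<tau> (s ` {1..M})) \<partial>Q {1..M})"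
  proof (intro nn_integral_cong)
    fix s :: "nat \<Rightarrow> 's"
    have "(\<lambda>n\<in>{1..M}. s (t n)) ` {1..M} = s ` t ` {1..M}"
      unfolding image_image by (intro image_cong) auto
    moreover have "basis f (\<lambda>n\<in>{1..M}. s (t n)) {1..M} {1..k} = basis f s (t ` {1..M}) (t ` {1..k})"
      by (rule basis_reindex) (use inj k in auto)
    ultimately show "of_bool (basis f (\<lambda>n\<in>{1..M}. s (t n)) {1..M} {1..k}) *
          \<phi> (\<tau> ((\<lambda>n\<in>{1..M}. s (t n)) ` {1..M})) = of_bool (basis f s {1..M} I) * \<phi> (\<tau> (s ` {1..M}))"
      by (simp only: im tI)
  qed
  finally show ?thesis by (simp add: k_def)
qed

text \<open>Almost surely exactly one index set is a basis, so these events partition the space, and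
  \<open>M choose k\<close> of them have size \<open>k\<close>. The range of summation can be
  changed to \<open>k \<le> \<zeta>\<close> because sizes above \<open>\<zeta>\<close> are excluded
  by \<open>dim\<close> and binomial coefficients vanish above \<open>M\<close>.\<close>

lemma nn_integral_decomposition:
  fixes \<phi> :: "real \<Rightarrow> ennreal"
  assumes [measurable]: "\<phi> \<in> borel_measurable borel"
  shows "(\<integral>\<^sup>+s. \<phi> (\<tau> (s ` {1..M})) \<partial>Q {1..M}) = (\<Sum>k\<le>\<zeta>. of_nat (M choose k) *
     (\<integral>\<^sup>+s. of_bool (full k s) * \<phi> (\<tau> (s ` {1..k})) * ennreal (\<tau> (s ` {1..k})) ^ (M - k) \<partial>Q {1..k}))"
    (is "_ = (\<Sum>k\<le>\<zeta>. _ * ?g k)")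
proof -
  have g_0: "?g k = 0" if "k > \<zeta>" for k
  proof -
    have "\<not> full k s" if "s \<in> space (Q {1..k})" for s
      using dim[OF that, of "{1..k}"] \<open>k > \<zeta>\<close> by (auto simp: full_def)
    then have "?g k = (\<integral>\<^sup>+s. 0 \<partial>Q {1..k})" by (intro nn_integral_cong) simp
    then show ?thesis by simp
  qed
  have "(\<integral>\<^sup>+s. \<phi> (\<tau> (s ` {1..M})) \<partial>Q {1..M})
      = (\<integral>\<^sup>+s. (\<Sum>I\<in>Pow {1..M}. of_bool (basis f s {1..M} I) * \<phi> (\<tau> (s ` {1..M}))) \<partial>Q {1..M})"
  proof (rule nn_integral_cong_AE)
    show "AE s in Q {1..M}. \<phi> (\<tau> (s ` {1..M})) =
        (\<Sum>I\<in>Pow {1..M}. of_bool (basis f s {1..M} I) * \<phi> (\<tau> (s ` {1..M})))"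
      using unique[of M]
    proof eventually_elim
      case (elim s)
      then obtain B where B: "\<And>I. basis f s {1..M} I \<longleftrightarrow> I = B" by blast
      then have "basis f s {1..M} B" by blast
      then have "B \<subseteq> {1..M}" by (simp add: basis_def)
      have "(\<Sum>I\<in>Pow {1..M}. of_bool (basis f s {1..M} I) * \<phi> (\<tau> (s ` {1..M})))
          = (\<Sum>I\<in>Pow {1..M}. if I = B then \<phi> (\<tau> (s ` {1..M})) else 0)"
        by (intro sum.cong) (simp_all add: B del: One_nat_def)
      also have "\<dots> = \<phi> (\<tau> (s ` {1..M}))"
        using \<open>B \<subseteq> {1..M}\<close> by (subst sum.delta) auto
      finally show ?case by (rule sym)
    qed
  qed
  also have "\<dots> = (\<Sum>I\<in>Pow {1..M}. \<integral>\<^sup>+s. of_bool (basis f s {1..M} I) * \<phi> (\<tau> (s ` {1..M})) \<partial>Q {1..M})"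
    by (intro nn_integral_sum borel_measurable_times_ennreal borel_measurable_of_bool basis_measurable
        measurable_compose[OF \<tau>_initial_measurable assms(1)] finite_atLeastAtMost order_refl)
  also have "\<dots> = (\<Sum>I\<in>Pow {1..M}. ?g (card I))"
  proof (rule sum.cong[OF refl])
    fix I assume "I \<in> Pow {1..M}"
    then have "I \<subseteq> {1..M}" "card I \<le> M" using card_mono[of "{1..M}" I] by auto
    then show "(\<integral>\<^sup>+s. of_bool (basis f s {1..M} I) * \<phi> (\<tau> (s ` {1..M})) \<partial>Q {1..M}) = ?g (card I)"
      by (rule trans[OF nn_integral_basis[OF assms] nn_integral_basis_initial[OF assms]])
  qed
  also have "\<dots> = (\<Sum>k\<le>M. of_nat (M choose k) * ?g k)"
    using sum_Pow_card[of "{1..M}" ?g] by simp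
  also have "\<dots> = (\<Sum>k\<in>{..M} \<union> {..\<zeta>}. of_nat (M choose k) * ?g k)"
    by (rule sum.mono_neutral_left) (auto simp: binomial_eq_0)
  also have "\<dots> = (\<Sum>k\<le>\<zeta>. of_nat (M choose k) * ?g k)"
    by (rule sum.mono_neutral_right) (auto simp: g_0 simp del: One_nat_def)
  finally show ?thesis .
qed

theorem sampling_bound:
  assumes eps: "0 < \<epsilon>" "\<epsilon> < 1" and \<zeta>: "0 < \<zeta>" "\<zeta> \<le> N"
  shows "measure (Q {1..N}) {s \<in> space (Q {1..N}). 1 - \<tau> (s ` {1..N}) > \<epsilon>} \<le> Phi \<epsilon> (\<zeta> - 1) N"
proof -
  \<comment> \<open>The measure \<open>F k\<close> of the opening comment: the law of
    \<open>\<tau>\<close> restricted to samples that are their own basis, in general of total mass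
    below 1.\<close>
  define \<nu> where "\<nu> k = distr (density (Q {1..k}) (\<lambda>s. of_bool (full k s))) borel (\<lambda>s. \<tau> (s ` {1..k}))" for k
  have sets_\<nu>[measurable_cong, simp]: "sets (\<nu> k) = sets borel" for k by (simp add: \<nu>_def)
  have nn_\<nu>: "(\<integral>\<^sup>+t. g t \<partial>\<nu> k) = (\<integral>\<^sup>+s. of_bool (full k s) * g (\<tau> (s ` {1..k})) \<partial>Q {1..k})"
    if [measurable]: "g \<in> borel_measurable borel" for g :: "real \<Rightarrow> ennreal" and k
    unfolding \<nu>_def by (subst nn_integral_distr, measurable, subst nn_integral_density) measurable
  have fin: "finite_measure (\<nu> k)" for k
  proof
    interpret Q: prob_space "Q {1..k}" by (rule prob_space_Q)
    have "emeasure (\<nu> k) (space (\<nu> k)) = (\<integral>\<^sup>+t. 1 \<partial>\<nu> k)" by simp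
    also have "\<dots> \<le> (\<integral>\<^sup>+s. 1 \<partial>Q {1..k})"
      by (subst nn_\<nu>, measurable) (intro nn_integral_mono; simp add: of_bool_def)
    also have "\<dots> < \<infinity>" by (simp add: Q.emeasure_space_1 del: One_nat_def)
    finally show "emeasure (\<nu> k) (space (\<nu> k)) \<noteq> \<infinity>" by simp
  qed
  have \<tau>01: "0 \<le> \<tau> \<omega>" "\<tau> \<omega> \<le> 1" for \<omega> by (auto simp: \<tau>_def)
  have range: "AE t in \<nu> k. 0 \<le> t \<and> t \<le> 1" for k
    unfolding \<nu>_def by (subst AE_distr_iff) (auto simp: \<tau>01 simp del: One_nat_def)
  have decomp: "(\<integral>\<^sup>+s. indicator U (\<tau> (s ` {1..M})) \<partial>Q {1..M}) =
      ennreal (\<Sum>k\<le>\<zeta>. real (M choose k) * (\<integral>t. indicator U t * t ^ (M - k) \<partial>\<nu> k))"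
    if U[measurable]: "U \<in> sets borel" for U M
  proof -
    have summand: "ennreal (\<integral>t. indicator U t * t ^ m \<partial>\<nu> k) =
        (\<integral>\<^sup>+s. of_bool (full k s) * indicator U (\<tau> (s ` {1..k})) * ennreal (\<tau> (s ` {1..k})) ^ m \<partial>Q {1..k})"
      for k m
    proof -
      have int: "integrable (\<nu> k) (\<lambda>t. indicator U t * t ^ m)"
        by (rule finite_measure.integrable_const_bound[OF fin, where B = 1], rule eventually_mono[OF range])
          (auto simp: power_le_one indicator_def)
      have "ennreal (\<integral>t. indicator U t * t ^ m \<partial>\<nu> k) = (\<integral>\<^sup>+t. ennreal (indicator U t * t ^ m) \<partial>\<nu> k)"
        by (rule nn_integral_eq_integral[OF int, symmetric], rule eventually_mono[OF range]) auto
      also have "\<dots> = (\<integral>\<^sup>+s. of_bool (full k s) *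
          ennreal (indicator U (\<tau> (s ` {1..k})) * \<tau> (s ` {1..k}) ^ m) \<partial>Q {1..k})"
        by (rule nn_\<nu>) measurable
      finally show ?thesis
        by (simp add: ennreal_mult' \<tau>01 ennreal_power mult.assoc ennreal_indicator)
    qed
    have nonneg: "0 \<le> (\<integral>t. indicator U t * t ^ m \<partial>\<nu> k)" for k m
      by (rule integral_nonneg_AE, rule eventually_mono[OF range]) auto
    have "(\<integral>\<^sup>+s. indicator U (\<tau> (s ` {1..M})) \<partial>Q {1..M}) =
       (\<Sum>k\<le>\<zeta>. ennreal (real (M choose k) * (\<integral>t. indicator U t * t ^ (M - k) \<partial>\<nu> k)))"
      using nonneg by (subst nn_integral_decomposition)
        (auto simp: ennreal_mult' summand ennreal_of_nat_eq_real_of_nat simp del: One_nat_def)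
    also have "\<dots> = ennreal (\<Sum>k\<le>\<zeta>. real (M choose k) * (\<integral>t. indicator U t * t ^ (M - k) \<partial>\<nu> k))"
      using nonneg by (intro sum_ennreal) auto
    finally show ?thesis .
  qed
  \<comment> \<open>With \<open>U\<close> the whole line, the decomposition computes the total mass
    of the sample law.\<close>
  have moment: "(\<Sum>k\<le>\<zeta>. real (m choose k) * (\<integral>t. t ^ (m - k) \<partial>\<nu> k)) = 1" for m
  proof -
    interpret Q: prob_space "Q {1..m}" by (rule prob_space_Q)
    show ?thesis using decomp[of UNIV m] by (simp add: Q.emeasure_space_1 del: One_nat_def)
  qed
  have "ennreal (measure (Q {1..N}) {s \<in> space (Q {1..N}). 1 - \<tau> (s ` {1..N}) > \<epsilon>})
      = (\<integral>\<^sup>+s. indicator {s \<in> space (Q {1..N}). 1 - \<tau> (s ` {1..N}) > \<epsilon>} s \<partial>Q {1..N})"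
  proof -
    interpret Q: prob_space "Q {1..N}" by (rule prob_space_Q)
    show ?thesis by (simp add: Q.emeasure_eq_measure del: One_nat_def)
  qed
  also have "\<dots> = (\<integral>\<^sup>+s. indicator {..<1 - \<epsilon>} (\<tau> (s ` {1..N})) \<partial>Q {1..N})"
    by (intro nn_integral_cong) (auto simp: indicator_def)
  also have "\<dots> = ennreal (\<Sum>k\<le>\<zeta>. real (N choose k) * (\<integral>t. indicator {..<1 - \<epsilon>} t * t ^ (N - k) \<partial>\<nu> k))"
    by (rule decomp) simp
  also have "\<dots> \<le> ennreal (Phi \<epsilon> (\<zeta> - 1) N)"
    by (intro ennreal_leI moment_bound sets_\<nu> fin range moment eps \<zeta>)
  finally show ?thesis
    using eps by (subst (asm) ennreal_le_iff) (auto simp: Phi_def intro!: sum_nonneg)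
qed

end

section \<open>The quasi-linear problem\<close>

lemma lex_le_antisym: "p \<preceq>\<^sub>l\<^sub>e\<^sub>x q \<Longrightarrow> q \<preceq>\<^sub>l\<^sub>e\<^sub>x p \<Longrightarrow> p = q"
  by (auto simp: lex_le_def lex_less_def)

lemma lex_less_iff_neq: "p \<preceq>\<^sub>l\<^sub>e\<^sub>x q \<Longrightarrow> p \<prec>\<^sub>l\<^sub>e\<^sub>x q \<longleftrightarrow> p \<noteq> q"
  by (auto simp: lex_le_def lex_less_def)

lemma feasible_set_anti_mono: "\<omega> \<subseteq> \<omega>' \<Longrightarrow> feasible_set X a b \<omega>' \<subseteq> feasible_set X a b \<omega>"
  by (auto simp: feasible_set_def)

lemma feasible_set_insert:
  "p \<in> feasible_set X a b (insert \<delta> \<omega>) \<longleftrightarrow>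
     p \<in> feasible_set X a b \<omega> \<and> a \<delta> \<bullet> snd p \<le> fst p * (b \<delta> \<bullet> snd p)"
  by (cases p) (auto simp: feasible_set_def)

text \<open>For fixed \<open>\<lambda>\<close> the constraints are linear in \<open>x\<close>, so
  the midpoint of two distinct optima is feasible with the same \<open>\<lambda>\<close>, and strong
  convexity makes it strictly cheaper.\<close>

lemma is_optimal_unique:
  fixes X :: "(real ^ 'd) set"
  assumes c: "strongly_convex_on X c"
    and p: "is_optimal X a b c \<omega> p" and q: "is_optimal X a b c \<omega> q"
  shows "p = q"
proof (rule ccontr)
  assume "p \<noteq> q"
  have "objective c p = objective c q"
    using p q by (auto simp: is_optimal_def intro: lex_le_antisym)
  then have fst_eq: "fst q = fst p" and c_eq: "c (snd q) = c (snd p)"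
    by (simp_all add: objective_def)
  define x y where "x = snd p" and "y = snd q"
  have "x \<noteq> y" using \<open>p \<noteq> q\<close> fst_eq by (auto simp: x_def y_def prod_eq_iff)
  have feas: "fst p \<ge> 0" "x \<in> X" "y \<in> X" "\<And>\<delta>. \<delta> \<in> \<omega> \<Longrightarrow> a \<delta> \<bullet> x \<le> fst p * (b \<delta> \<bullet> x)"
    "\<And>\<delta>. \<delta> \<in> \<omega> \<Longrightarrow> a \<delta> \<bullet> y \<le> fst p * (b \<delta> \<bullet> y)"
    using p q fst_eq by (auto simp: is_optimal_def feasible_set_def x_def y_def split: prod.splits)
  obtain m where m: "m > 0" and sc: "\<And>x y t. x \<in> X \<Longrightarrow> y \<in> X \<Longrightarrow> t \<in> {0..1} \<Longrightarrow>
      c ((1 - t) *\<^sub>R x + t *\<^sub>R y) \<le> (1 - t) * c x + t * c y - m / 2 * t * (1 - t) * (norm (x - y))\<^sup>2"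
    using c unfolding strongly_convex_on_def by blast
  define z where "z = (1 - 1/2) *\<^sub>R x + (1/2 :: real) *\<^sub>R y"
  have "z \<in> X"
    using c feas unfolding z_def strongly_convex_on_def by (intro convexD) auto
  moreover have "a \<delta> \<bullet> z \<le> fst p * (b \<delta> \<bullet> z)" if "\<delta> \<in> \<omega>" for \<delta>
    using feas(4,5)[OF that] by (simp add: z_def inner_add_right algebra_simps)
  ultimately have "(fst p, z) \<in> feasible_set X a b \<omega>"
    using feas(1) by (simp add: feasible_set_def)
  then have "objective c p \<preceq>\<^sub>l\<^sub>e\<^sub>x objective c (fst p, z)"
    using p by (auto simp: is_optimal_def)
  then have "c x \<le> c z" by (auto simp: objective_def lex_le_def lex_less_def x_def)
  \<comment> \<open>The constant is \<open>m / 2 * t * (1 - t)\<close> at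
    \<open>t = 1/2\<close>.\<close>
  moreover have "c z \<le> c x - m / 8 * (norm (x - y))\<^sup>2"
    using sc[OF feas(2,3), of "1/2"] c_eq by (simp add: z_def x_def y_def)
  moreover have "m / 8 * (norm (x - y))\<^sup>2 > 0" using m \<open>x \<noteq> y\<close> by simp
  ultimately show False by linarith
qed

theorem theorem6:
  fixes X :: "(real ^ 'd) set"
    and P :: "'s measure"
    and a b :: "'s \<Rightarrow> real ^ 'd"
    and c :: "real ^ 'd \<Rightarrow> real"
    and \<zeta> N :: nat
    and \<epsilon> :: real
  assumes X: "compact X" "convex X" "interior X \<noteq> {}" "0 \<notin> X"
    and P: "prob_space P"
    and b_pos: "\<And>\<delta> x. \<delta> \<in> space P \<Longrightarrow> x \<in> X \<Longrightarrow> b \<delta> \<bullet> x > 0"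
    and c: "strongly_convex_on X c"
    and optimum_exists: "\<And>\<omega>. finite \<omega> \<Longrightarrow> \<omega> \<subseteq> space P \<Longrightarrow> \<exists>p. is_optimal X a b c \<omega> p"
    and measurable: "cost_events_measurable P X a b c"
    and non_deg: "\<And>M. M > 0 \<Longrightarrow> AE s in sample_measure P M. non_degenerate X a b c M s"
    and zeta_pos: "\<zeta> > 0"
    and zeta: "\<And>\<omega> \<beta>. finite \<omega> \<Longrightarrow> \<omega> \<subseteq> space P \<Longrightarrow> essential_set X a b c \<omega> \<beta> \<Longrightarrow> card \<beta> \<le> \<zeta>"
    and N: "N \<ge> \<zeta>"
    and eps: "0 < \<epsilon>" "\<epsilon> < 1"
  shows "measure (sample_measure P N)
           {s \<in> space (sample_measure P N). violating_prob P X a b c N s > \<epsilon>}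
         \<le> Phi \<epsilon> (\<zeta> - 1) N"
proof -

  \<comment> \<open>Costs and optima of nested constraint sets\<close>
  have opt: "is_optimal X a b c \<omega> (Opt X a b c \<omega>)" if "finite \<omega>" "\<omega> \<subseteq> space P" for \<omega>
    unfolding Opt_def
    using optimum_exists[OF that] is_optimal_unique[OF c] by (metis theI_unique)
  have Opt_eq: "Opt X a b c \<omega> = p" if "is_optimal X a b c \<omega> p" for \<omega> p
    unfolding Opt_def using that is_optimal_unique[OF c] by blast
  have mono: "Cost X a b c \<omega> \<preceq>\<^sub>l\<^sub>e\<^sub>x Cost X a b c \<omega>'"
    if "finite \<omega>'" "\<omega>' \<subseteq> space P" "\<omega> \<subseteq> \<omega>'" for \<omega> \<omega>'
  proof -
    have "finite \<omega>" "\<omega> \<subseteq> space P" using that finite_subset by auto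
    then show ?thesis
      using opt[of \<omega>] opt[OF that(1,2)] feasible_set_anti_mono[OF that(3), of X a b]
      unfolding Cost_def is_optimal_def by blast
  qed
  \<comment> \<open>The optimum of the larger problem is feasible for the smaller one and attains
    its optimal cost; uniqueness does the rest.\<close>
  have Opt_cong: "Opt X a b c \<omega> = Opt X a b c \<omega>'"
    if "finite \<omega>'" "\<omega>' \<subseteq> space P" "\<omega> \<subseteq> \<omega>'" "Cost X a b c \<omega> = Cost X a b c \<omega>'" for \<omega> \<omega>'
  proof (rule Opt_eq)
    have "finite \<omega>" "\<omega> \<subseteq> space P" using that finite_subset by auto
    then show "is_optimal X a b c \<omega> (Opt X a b c \<omega>')"
      using opt[of \<omega>] opt[OF that(1,2)] feasible_set_anti_mono[OF that(3), of X a b] that(4)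
      unfolding Cost_def is_optimal_def by auto
  qed
  \<comment> \<open>This is the source of locality: the right-hand side depends on
    \<open>\<omega>\<close> through its optimal solution only.\<close>
  have satisfied: "Cost X a b c (insert \<delta> \<omega>) = Cost X a b c \<omega> \<longleftrightarrow>
      a \<delta> \<bullet> snd (Opt X a b c \<omega>) \<le> fst (Opt X a b c \<omega>) * (b \<delta> \<bullet> snd (Opt X a b c \<omega>))"
    if "finite \<omega>" "\<omega> \<subseteq> space P" "\<delta> \<in> space P" for \<omega> \<delta>
  proof
    assume "Cost X a b c (insert \<delta> \<omega>) = Cost X a b c \<omega>"
    then have "Opt X a b c \<omega> = Opt X a b c (insert \<delta> \<omega>)"
      by (intro Opt_cong) (use that in auto)
    then show "a \<delta> \<bullet> snd (Opt X a b c \<omega>) \<le> fst (Opt X a b c \<omega>) * (b \<delta> \<bullet> snd (Opt X a b c \<omega>))"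
      using opt[of "insert \<delta> \<omega>"] that by (simp add: is_optimal_def feasible_set_insert)
  next
    assume "a \<delta> \<bullet> snd (Opt X a b c \<omega>) \<le> fst (Opt X a b c \<omega>) * (b \<delta> \<bullet> snd (Opt X a b c \<omega>))"
    then have "is_optimal X a b c (insert \<delta> \<omega>) (Opt X a b c \<omega>)"
      using opt[OF that(1,2)] by (simp add: is_optimal_def feasible_set_insert)
    then show "Cost X a b c (insert \<delta> \<omega>) = Cost X a b c \<omega>"
      by (simp add: Cost_def Opt_eq)
  qed
  \<comment> \<open>A competing set of elements lifts to an index set of the same cardinality by
    choosing one index for each element, so minimality over indices gives minimality over
    elements.\<close>
  have essential: "essential_set X a b c (s ` {1..M}) (s ` I)" if "basis (Cost X a b c) s {1..M} I" for s M I
    unfolding essential_set_def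
  proof (intro conjI allI impI)
    show "s ` I \<subseteq> s ` {1..M}" "Cost X a b c (s ` I) = Cost X a b c (s ` {1..M})"
      using that by (auto simp: basis_def)
    fix \<beta> assume \<beta>: "\<beta> \<subseteq> s ` {1..M} \<and> Cost X a b c \<beta> = Cost X a b c (s ` {1..M})"
    then obtain I' where I': "I' \<subseteq> {1..M}" "inj_on s I'" "\<beta> = s ` I'"
      by (meson subset_image_inj)
    have "finite I" using that finite_subset[of I "{1..M}"] by (auto simp: basis_def)
    then have "card (s ` I) \<le> card I" by (rule card_image_le)
    also have "card I \<le> card I'" using that \<beta> I' by (auto simp: basis_def)
    also have "card I' = card \<beta>" using I' by (simp add: card_image)
    finally show "card (s ` I) \<le> card \<beta>" .
  qed
  have sample: "s ` I \<subseteq> space P" "finite (s ` {1..M})"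
    if "s \<in> space (sample_measure P M)" "I \<subseteq> {1..M}" for s M I
    using that by (auto simp: space_PiM PiE_def Pi_def)

  \<comment> \<open>The cost as an instance of the abstract setting\<close>
  interpret prob_space P by (rule P)
  interpret violator_sampling P "Cost X a b c" \<zeta>
  proof
    fix A B C assume *: "finite C" "C \<subseteq> space P" "A \<subseteq> B" "B \<subseteq> C" "Cost X a b c A = Cost X a b c C"
    then have "Cost X a b c A \<preceq>\<^sub>l\<^sub>e\<^sub>x Cost X a b c B" "Cost X a b c B \<preceq>\<^sub>l\<^sub>e\<^sub>x Cost X a b c C"
      by (meson mono finite_subset subset_trans)+
    then show "Cost X a b c B = Cost X a b c C" using *(5) lex_le_antisym by metis
  next
    fix A B \<delta> assume *: "finite B" "B \<subseteq> space P" "\<delta> \<in> space P" "A \<subseteq> B" "Cost X a b c A = Cost X a b c B"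
    then have "finite A" "A \<subseteq> space P" using finite_subset by auto
    then show "Cost X a b c (insert \<delta> A) = Cost X a b c A \<longleftrightarrow> Cost X a b c (insert \<delta> B) = Cost X a b c B"
      using satisfied[of A \<delta>] satisfied[of B \<delta>] Opt_cong[OF *(1,2,4,5)] * by simp
  next
    fix M :: nat and I assume I: "I \<subseteq> {1..M}"
    let ?E = "{s \<in> space (sample_measure P M). Cost X a b c (s ` I) \<prec>\<^sub>l\<^sub>e\<^sub>x Cost X a b c (s ` {1..M})}"
    have "?E \<in> sets (sample_measure P M)"
      using measurable I unfolding cost_events_measurable_def by blast
    moreover have "{s \<in> space (sample_measure P M). Cost X a b c (s ` I) = Cost X a b c (s ` {1..M})}
        = space (sample_measure P M) - ?E"
    proof -
      have "Cost X a b c (s ` I) \<prec>\<^sub>l\<^sub>e\<^sub>x Cost X a b c (s ` {1..M}) \<longleftrightarrow>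
          Cost X a b c (s ` I) \<noteq> Cost X a b c (s ` {1..M})" if "s \<in> space (sample_measure P M)" for s
        using sample[OF that order_refl] I by (intro lex_less_iff_neq mono image_mono) auto
      then show ?thesis by blast
    qed
    ultimately show "{s \<in> space (sample_measure P M). Cost X a b c (s ` I) = Cost X a b c (s ` {1..M})}
        \<in> sets (sample_measure P M)" by auto
  next
    fix M
    show "AE s in sample_measure P M. \<exists>!I. basis (Cost X a b c) s {1..M} I"
    \<comment> \<open>Non-degeneracy is assumed for positive sizes; the empty sample has the empty
      basis only.\<close>
    proof (cases "M = 0")
      case True
      then have "basis (Cost X a b c) s {1..M} I \<longleftrightarrow> I = {}" for s I
        by (auto simp: basis_def)
      then show ?thesis by simp
    next
      case False
      then have "AE s in sample_measure P M. non_degenerate X a b c M s" by (intro non_deg) simp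
      then show ?thesis
      proof eventually_elim
        case (elim s)
        \<comment> \<open>Some basis exists and every basis gives an essential set, so the unique
          index set of non-degeneracy is the only basis.\<close>
        obtain I where "basis (Cost X a b c) s {1..M} I" using basis_exists by blast
        then show ?case
          using elim essential unfolding non_degenerate_def by (metis basis_def)
      qed
    qed
  next
    fix M s I assume *: "s \<in> space (sample_measure P M)" "basis (Cost X a b c) s {1..M} I"
    \<comment> \<open>A repeated element would allow a smaller index set with the same image.
      Injectivity lets the bound \<open>\<zeta>\<close> on elements count indices.\<close>
    have "inj_on s I"
    proof -
      obtain I' where I': "I' \<subseteq> I" "inj_on s I'" "s ` I = s ` I'"
        by (metis subset_image_inj order_refl)
      have "finite I" using *(2) finite_subset[of I "{1..M}"] by (auto simp: basis_def)
      moreover have "card I \<le> card I'" using *(2) I' by (auto simp: basis_def)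
      ultimately have "I' = I" using I'(1) card_seteq by blast
      then show ?thesis using I'(2) by simp
    qed
    then show "card I \<le> \<zeta>"
      using zeta[OF _ _ essential[OF *(2)]] sample[OF *(1) order_refl] by (simp add: card_image)
  qed
  \<comment> \<open>By monotonicity a further constraint either strictly raises the cost or leaves
    it unchanged, so the two events are complementary.\<close>
  have "violating_prob P X a b c N s = 1 - \<tau> (s ` {1..N})" if s: "s \<in> space (sample_measure P N)" for s
  proof -
    let ?\<omega> = "s ` {1..N}"
    let ?S = "{\<delta> \<in> space P. Cost X a b c (insert \<delta> ?\<omega>) = Cost X a b c ?\<omega>}"
    have \<omega>: "finite ?\<omega>" "?\<omega> \<subseteq> space P" using sample[OF s order_refl] by auto
    have "Cost X a b c ?\<omega> \<prec>\<^sub>l\<^sub>e\<^sub>x Cost X a b c (?\<omega> \<union> {\<delta>}) \<longleftrightarrow>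
        Cost X a b c (insert \<delta> ?\<omega>) \<noteq> Cost X a b c ?\<omega>" if "\<delta> \<in> space P" for \<delta>
      using lex_less_iff_neq[OF mono[OF _ _ subset_insertI[of ?\<omega> \<delta>]]] that \<omega> by auto
    then have "{\<delta> \<in> space P. Cost X a b c ?\<omega> \<prec>\<^sub>l\<^sub>e\<^sub>x Cost X a b c (?\<omega> \<union> {\<delta>})} = space P - ?S" by blast
    then show ?thesis
      unfolding violating_prob_def \<tau>_def using prob_compl[OF sat_event[OF _ s]] by simp
  qed
  then have "{s \<in> space (sample_measure P N). violating_prob P X a b c N s > \<epsilon>}
      = {s \<in> space (sample_measure P N). 1 - \<tau> (s ` {1..N}) > \<epsilon>}"
    by auto
  then show ?thesis using sampling_bound[OF eps zeta_pos N] by simp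
qed

end
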